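(* Let $\mathbb{X}$ be an additive symmetric monoidal category. Monoidal coalgebra modalities on $\mathbb{X}$ correspond bijectively to additive bialgebra modalities on $\mathbb{X}$. The bijection keeps the underlying coalgebra modality $(!,\delta,\varepsilon,\Delta,e)$ and is given by the following two mutually inverse constructions. A monoidal coalgebra modality $(!,\delta,\varepsilon,m_\otimes,m_K,\Delta,e)$ is sent to the additive bialgebra modality $(!,\delta,\varepsilon,\Delta,e,\nabla,u)$ with $$\nabla := (\delta\otimes\delta)\, m_\otimes\, !(\varepsilon\otimes e+e\otimes\varepsilon): {!A}\otimes{!A}\to{!A},\qquad u := m_K\, !(0): K\to {!A}.$$ An additive bialgebra modality $(!,\delta,\varepsilon,\Delta,e,\nabla,u)$ is sent to the monoidal coalgebra modality $(!,\delta,\varepsilon,m_\otimes,m_K,\Delta,e)$ with $$m_\otimes := (\delta\otimes\delta)\,\big(!(1\otimes u)\otimes !(u\otimes 1)\big)\,\nabla\,\delta\; !(\Delta)\; !\big(!(\varepsilon\otimes e)\otimes !(e\otimes\varepsilon)\big)\; !(\varepsilon\otimes\varepsilon): {!A}\otimes{!B}\to {!(A\otimes B)},$$ $$m_K := u\,\delta\, !(e): K\to {!K}.$$ Therefore the following are equivalent: (i) an additive linear category; (ii) an additive symmetric monoidal category with an additive bialgebra modality.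
   Context: Composition is in diagrammatic order ($fg$ means first $f$, then $g$). Symmetric monoidal categories are treated as strict (associators and unitors suppressed), with tensor $\otimes$, unit $K$, symmetry $\sigma:A\otimes B\to B\otimes A$. An additive symmetric monoidal category is a symmetric monoidal category enriched in commutative monoids (hom-sets have $+$ and $0$, no negatives, no biproducts assumed), with composition and $\otimes$ preserving $+$ and $0$ in each variable. A coalgebra modality $(!,\delta,\varepsilon,\Delta,e)$ is a comonad $(!,\delta,\varepsilon)$, $\delta:{!A}\to{!!A}$, $\varepsilon:{!A}\to A$, with natural transformations $\Delta:{!A}\to{!A}\otimes{!A}$, $e:{!A}\to K$ such that each $({!A},\Delta,e)$ is a cocommutative comonoid and $\delta\Delta=\Delta(\delta\otimes\delta)$. A bialgebra modality $(!,\delta,\varepsilon,\Delta,e,\nabla,u)$ (on an additive symmetric monoidal category) is a coalgebra modality with natural transformations $\nabla:{!A}\otimes{!A}\to{!A}$, $u:K\to{!A}$ such that $({!A},\nabla,u)$ is a commutative monoid, $\nabla e=e\otimes e$, $u\Delta=u\otimes u$, $ue=1$, $\nabla\Delta=(\Delta\otimes\Delta)(1\otimes\sigma\otimes1)(\nabla\otimes\nabla)$, and $\nabla\varepsilon=\varepsilon\otimes e+e\otimes\varepsilon$. It is additive if for all parallel maps $f,g$: $!(f+g)=\Delta(!(f)\otimes!(g))\nabla$ and $!(0)=eu$. A monoidal coalgebra modality $(!,\delta,\varepsilon,m_\otimes,m_K,\Delta,e)$ is a coalgebra modality with a natural transformation $m_\otimes:{!A}\otimes{!B}\to{!(A\otimes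 B)}$ and a map $m_K:K\to{!K}$ such that: $(!,m_\otimes,m_K)$ is a (lax) symmetric monoidal endofunctor; $\delta,\varepsilon$ are monoidal: $m_\otimes\delta=(\delta\otimes\delta)m_\otimes!(m_\otimes)$, $m_K\delta=m_K!(m_K)$, $m_\otimes\varepsilon=\varepsilon\otimes\varepsilon$, $m_K\varepsilon=1$; $\Delta,e$ are monoidal: $m_\otimes\Delta=(\Delta\otimes\Delta)(1\otimes\sigma\otimes1)(m_\otimes\otimes m_\otimes)$, $m_\otimes e=e\otimes e$, $m_K\Delta=m_K\otimes m_K$, $m_Ke=1$; and $\Delta,e$ are $!$-coalgebra morphisms: $\delta\,!(\Delta)=\Delta(\delta\otimes\delta)m_\otimes$, $\delta\,!(e)=e\,m_K$. An additive linear category is an additive symmetric monoidal category equipped with a monoidal coalgebra modality. *)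

theory Defs
  imports Main
begin

text \<open>
  The objects of a category are all elements of a type \<open>'o\<close> and its arrows are all elements of a
  type \<open>'a\<close>.  Object and arrow assignments are therefore plain functions, without any junk outside
  a carrier, and equality of structures is equality in HOL.  Only composition and the sum of
  arrows are partial: their values are meaningful on composable and on parallel pairs,
  respectively.  Composition is written in diagrammatic order.
\<close>

record ('o, 'a) smc_data =
  Dom :: "'a \<Rightarrow> 'o"
  Cod :: "'a \<Rightarrow> 'o"
  ident :: "'o \<Rightarrow> 'a"  ("\<one>\<index>")
  seq :: "'a \<Rightarrow> 'a \<Rightarrow> 'a"  (infixl "\<cdot>\<index>" 70)
  tobj :: "'o \<Rightarrow> 'o \<Rightarrow> 'o"  (infixl "\<boxtimes>\<index>" 75)
  unit_obj :: 'o  ("\<K>\<index>")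
  tmap :: "'a \<Rightarrow> 'a \<Rightarrow> 'a"  (infixl "\<otimes>\<index>" 75)
  symm :: "'o \<Rightarrow> 'o \<Rightarrow> 'a"  ("\<sigma>\<index>")

record ('o, 'a) additive_smc_data = "('o, 'a) smc_data" +
  madd :: "'a \<Rightarrow> 'a \<Rightarrow> 'a"  (infixl "\<oplus>\<index>" 65)
  mzero :: "'o \<Rightarrow> 'o \<Rightarrow> 'a"  ("\<zero>\<index>")

definition homset :: "('o, 'a, 'z) smc_data_scheme \<Rightarrow> 'o \<Rightarrow> 'o \<Rightarrow> 'a set"  ("hom\<index>")
  where "homset X A B = {f. Dom X f = A \<and> Cod X f = B}"

text \<open>
  Strict symmetric monoidal categories: associators and unitors are identities, so they appear as
  equations between objects and between arrows.
\<close>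

locale smc =
  fixes X :: "('o, 'a, 'z) smc_data_scheme"  (structure)
  assumes ident_hom: "\<one> A \<in> hom A A"
    and seq_hom: "f \<in> hom A B \<Longrightarrow> g \<in> hom B C \<Longrightarrow> f \<cdot> g \<in> hom A C"
    and ident_seq: "f \<in> hom A B \<Longrightarrow> \<one> A \<cdot> f = f"
    and seq_ident: "f \<in> hom A B \<Longrightarrow> f \<cdot> \<one> B = f"
    and seq_assoc: "f \<in> hom A B \<Longrightarrow> g \<in> hom B C \<Longrightarrow> h \<in> hom C D \<Longrightarrow> (f \<cdot> g) \<cdot> h = f \<cdot> (g \<cdot> h)"
    and tmap_hom: "f \<in> hom A B \<Longrightarrow> g \<in> hom C D \<Longrightarrow> f \<otimes> g \<in> hom (A \<boxtimes> C) (B \<boxtimes> D)"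
    and tmap_ident: "\<one> A \<otimes> \<one> B = \<one> (A \<boxtimes> B)"
    and interchange: "f \<in> hom A B \<Longrightarrow> g \<in> hom B C \<Longrightarrow> h \<in> hom A' B' \<Longrightarrow> k \<in> hom B' C' \<Longrightarrow>
      (f \<cdot> g) \<otimes> (h \<cdot> k) = (f \<otimes> h) \<cdot> (g \<otimes> k)"
    and tobj_assoc: "(A \<boxtimes> B) \<boxtimes> C = A \<boxtimes> (B \<boxtimes> C)"
    and unit_tobj: "\<K> \<boxtimes> A = A"
    and tobj_unit: "A \<boxtimes> \<K> = A"
    and tmap_assoc: "(f \<otimes> g) \<otimes> h = f \<otimes> (g \<otimes> h)"
    and unit_tmap: "\<one> \<K> \<otimes> f = f"
    and tmap_unit: "f \<otimes> \<one> \<K> = f"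
    and symm_hom: "\<sigma> A B \<in> hom (A \<boxtimes> B) (B \<boxtimes> A)"
    and symm_natural: "f \<in> hom A B \<Longrightarrow> g \<in> hom C D \<Longrightarrow> (f \<otimes> g) \<cdot> \<sigma> B D = \<sigma> A C \<cdot> (g \<otimes> f)"
    and symm_symm: "\<sigma> A B \<cdot> \<sigma> B A = \<one> (A \<boxtimes> B)"
    and symm_unit: "\<sigma> A \<K> = \<one> A"
    and hexagon: "\<sigma> A (B \<boxtimes> C) = (\<sigma> A B \<otimes> \<one> C) \<cdot> (\<one> B \<otimes> \<sigma> A C)"

locale additive_smc = smc X
  for X :: "('o, 'a, 'z) additive_smc_data_scheme"  (structure) +
  assumes madd_hom: "f \<in> hom A B \<Longrightarrow> g \<in> hom A B \<Longrightarrow> f \<oplus> g \<in> hom A B"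
    and mzero_hom: "\<zero> A B \<in> hom A B"
    and madd_assoc: "f \<in> hom A B \<Longrightarrow> g \<in> hom A B \<Longrightarrow> h \<in> hom A B \<Longrightarrow> (f \<oplus> g) \<oplus> h = f \<oplus> (g \<oplus> h)"
    and madd_commute: "f \<in> hom A B \<Longrightarrow> g \<in> hom A B \<Longrightarrow> f \<oplus> g = g \<oplus> f"
    and mzero_madd: "f \<in> hom A B \<Longrightarrow> \<zero> A B \<oplus> f = f"
    and seq_madd: "f \<in> hom A B \<Longrightarrow> g \<in> hom B C \<Longrightarrow> h \<in> hom B C \<Longrightarrow>
      f \<cdot> (g \<oplus> h) = (f \<cdot> g) \<oplus> (f \<cdot> h)"
    and madd_seq: "f \<in> hom A B \<Longrightarrow> g \<in> hom A B \<Longrightarrow> h \<in> hom B C \<Longrightarrow>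
      (f \<oplus> g) \<cdot> h = (f \<cdot> h) \<oplus> (g \<cdot> h)"
    and seq_mzero: "f \<in> hom A B \<Longrightarrow> f \<cdot> \<zero> B C = \<zero> A C"
    and mzero_seq: "f \<in> hom B C \<Longrightarrow> \<zero> A B \<cdot> f = \<zero> A C"
    and tmap_madd: "f \<in> hom A B \<Longrightarrow> g \<in> hom C D \<Longrightarrow> h \<in> hom C D \<Longrightarrow>
      f \<otimes> (g \<oplus> h) = (f \<otimes> g) \<oplus> (f \<otimes> h)"
    and madd_tmap: "f \<in> hom A B \<Longrightarrow> g \<in> hom A B \<Longrightarrow> h \<in> hom C D \<Longrightarrow>
      (f \<oplus> g) \<otimes> h = (f \<otimes> h) \<oplus> (g \<otimes> h)"
    and tmap_mzero: "f \<in> hom A B \<Longrightarrow> f \<otimes> \<zero> C D = \<zero> (A \<boxtimes> C) (B \<boxtimes> D)"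
    and mzero_tmap: "f \<in> hom C D \<Longrightarrow> \<zero> A B \<otimes> f = \<zero> (A \<boxtimes> C) (B \<boxtimes> D)"

text \<open>
  The functor \<open>!\<close> is given by \<open>bang\<close> on objects and \<open>bmap\<close> on arrows.
\<close>

locale coalgebra_modality = smc X
  for X :: "('o, 'a, 'z) smc_data_scheme"  (structure) +
  fixes bang :: "'o \<Rightarrow> 'o" and bmap :: "'a \<Rightarrow> 'a"
    and \<delta> \<epsilon> \<Delta> e :: "'o \<Rightarrow> 'a"
  assumes bmap_hom: "f \<in> hom A B \<Longrightarrow> bmap f \<in> hom (bang A) (bang B)"
    and bmap_ident: "bmap (\<one> A) = \<one> (bang A)"
    and bmap_seq: "f \<in> hom A B \<Longrightarrow> g \<in> hom B C \<Longrightarrow> bmap (f \<cdot> g) = bmap f \<cdot> bmap g"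
    and delta_hom: "\<delta> A \<in> hom (bang A) (bang (bang A))"
    and delta_natural: "f \<in> hom A B \<Longrightarrow> bmap f \<cdot> \<delta> B = \<delta> A \<cdot> bmap (bmap f)"
    and eps_hom: "\<epsilon> A \<in> hom (bang A) A"
    and eps_natural: "f \<in> hom A B \<Longrightarrow> bmap f \<cdot> \<epsilon> B = \<epsilon> A \<cdot> f"
    and delta_eps: "\<delta> A \<cdot> \<epsilon> (bang A) = \<one> (bang A)"
    and delta_bmap_eps: "\<delta> A \<cdot> bmap (\<epsilon> A) = \<one> (bang A)"
    and delta_delta: "\<delta> A \<cdot> \<delta> (bang A) = \<delta> A \<cdot> bmap (\<delta> A)"
    and Delta_hom: "\<Delta> A \<in> hom (bang A) (bang A \<boxtimes> bang A)"
    and Delta_natural: "f \<in> hom A B \<Longrightarrow> bmap f \<cdot> \<Delta> B = \<Delta> A \<cdot> (bmap f \<otimes> bmap f)"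
    and e_hom: "e A \<in> hom (bang A) \<K>"
    and e_natural: "f \<in> hom A B \<Longrightarrow> bmap f \<cdot> e B = e A"
    and Delta_coassoc: "\<Delta> A \<cdot> (\<Delta> A \<otimes> \<one> (bang A)) = \<Delta> A \<cdot> (\<one> (bang A) \<otimes> \<Delta> A)"
    and Delta_counit_left: "\<Delta> A \<cdot> (e A \<otimes> \<one> (bang A)) = \<one> (bang A)"
    and Delta_counit_right: "\<Delta> A \<cdot> (\<one> (bang A) \<otimes> e A) = \<one> (bang A)"
    and Delta_cocomm: "\<Delta> A \<cdot> \<sigma> (bang A) (bang A) = \<Delta> A"
    and delta_Delta: "\<delta> A \<cdot> \<Delta> (bang A) = \<Delta> A \<cdot> (\<delta> A \<otimes> \<delta> A)"

locale bialgebra_modality = additive_smc X + coalgebra_modality X bang bmap \<delta> \<epsilon> \<Delta> e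
  for X :: "('o, 'a, 'z) additive_smc_data_scheme"  (structure)
    and bang :: "'o \<Rightarrow> 'o" and bmap :: "'a \<Rightarrow> 'a"
    and \<delta> \<epsilon> \<Delta> e :: "'o \<Rightarrow> 'a" +
  fixes nabla u :: "'o \<Rightarrow> 'a"
  assumes nabla_hom: "nabla A \<in> hom (bang A \<boxtimes> bang A) (bang A)"
    and nabla_natural: "f \<in> hom A B \<Longrightarrow> (bmap f \<otimes> bmap f) \<cdot> nabla B = nabla A \<cdot> bmap f"
    and u_hom: "u A \<in> hom \<K> (bang A)"
    and u_natural: "f \<in> hom A B \<Longrightarrow> u A \<cdot> bmap f = u B"
    and nabla_assoc: "(nabla A \<otimes> \<one> (bang A)) \<cdot> nabla A = (\<one> (bang A) \<otimes> nabla A) \<cdot> nabla A"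
    and nabla_unit_left: "(u A \<otimes> \<one> (bang A)) \<cdot> nabla A = \<one> (bang A)"
    and nabla_unit_right: "(\<one> (bang A) \<otimes> u A) \<cdot> nabla A = \<one> (bang A)"
    and nabla_comm: "\<sigma> (bang A) (bang A) \<cdot> nabla A = nabla A"
    and nabla_e: "nabla A \<cdot> e A = e A \<otimes> e A"
    and u_Delta: "u A \<cdot> \<Delta> A = u A \<otimes> u A"
    and u_e: "u A \<cdot> e A = \<one> \<K>"
    and nabla_Delta: "nabla A \<cdot> \<Delta> A =
      (\<Delta> A \<otimes> \<Delta> A) \<cdot> (\<one> (bang A) \<otimes> \<sigma> (bang A) (bang A) \<otimes> \<one> (bang A)) \<cdot> (nabla A \<otimes> nabla A)"
    and nabla_eps: "nabla A \<cdot> \<epsilon> A = (\<epsilon> A \<otimes> e A) \<oplus> (e A \<otimes> \<epsilon> A)"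

locale additive_bialgebra_modality = bialgebra_modality +
  assumes bmap_madd: "f \<in> hom A B \<Longrightarrow> g \<in> hom A B \<Longrightarrow>
      bmap (f \<oplus> g) = \<Delta> A \<cdot> (bmap f \<otimes> bmap g) \<cdot> nabla B"
    and bmap_mzero: "bmap (\<zero> A B) = e A \<cdot> u B"

locale monoidal_coalgebra_modality = coalgebra_modality X bang bmap \<delta> \<epsilon> \<Delta> e
  for X :: "('o, 'a, 'z) smc_data_scheme"  (structure)
    and bang :: "'o \<Rightarrow> 'o" and bmap :: "'a \<Rightarrow> 'a"
    and \<delta> \<epsilon> \<Delta> e :: "'o \<Rightarrow> 'a" +
  fixes m :: "'o \<Rightarrow> 'o \<Rightarrow> 'a" and mK :: 'a
  assumes m_hom: "m A B \<in> hom (bang A \<boxtimes> bang B) (bang (A \<boxtimes> B))"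
    and m_natural: "f \<in> hom A B \<Longrightarrow> g \<in> hom C D \<Longrightarrow>
      (bmap f \<otimes> bmap g) \<cdot> m B D = m A C \<cdot> bmap (f \<otimes> g)"
    and mK_hom: "mK \<in> hom \<K> (bang \<K>)"
    and m_assoc: "(m A B \<otimes> \<one> (bang C)) \<cdot> m (A \<boxtimes> B) C = (\<one> (bang A) \<otimes> m B C) \<cdot> m A (B \<boxtimes> C)"
    and m_unit_left: "(mK \<otimes> \<one> (bang A)) \<cdot> m \<K> A = \<one> (bang A)"
    and m_unit_right: "(\<one> (bang A) \<otimes> mK) \<cdot> m A \<K> = \<one> (bang A)"
    and m_symm: "\<sigma> (bang A) (bang B) \<cdot> m B A = m A B \<cdot> bmap (\<sigma> A B)"
    and m_delta: "m A B \<cdot> \<delta> (A \<boxtimes> B) = (\<delta> A \<otimes> \<delta> B) \<cdot> m (bang A) (bang B) \<cdot> bmap (m A B)"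
    and mK_delta: "mK \<cdot> \<delta> \<K> = mK \<cdot> bmap mK"
    and m_eps: "m A B \<cdot> \<epsilon> (A \<boxtimes> B) = \<epsilon> A \<otimes> \<epsilon> B"
    and mK_eps: "mK \<cdot> \<epsilon> \<K> = \<one> \<K>"
    and m_Delta: "m A B \<cdot> \<Delta> (A \<boxtimes> B) =
      (\<Delta> A \<otimes> \<Delta> B) \<cdot> (\<one> (bang A) \<otimes> \<sigma> (bang A) (bang B) \<otimes> \<one> (bang B)) \<cdot> (m A B \<otimes> m A B)"
    and m_e: "m A B \<cdot> e (A \<boxtimes> B) = e A \<otimes> e B"
    and mK_Delta: "mK \<cdot> \<Delta> \<K> = mK \<otimes> mK"
    and mK_e: "mK \<cdot> e \<K> = \<one> \<K>"
    and Delta_coalgebra: "\<delta> A \<cdot> bmap (\<Delta> A) = \<Delta> A \<cdot> (\<delta> A \<otimes> \<delta> A) \<cdot> m (bang A) (bang A)"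
    and e_coalgebra: "\<delta> A \<cdot> bmap (e A) = e A \<cdot> mK"

text \<open>
  Bundled structures.  The first component of each pair is the underlying coalgebra modality
  \<open>(!, \<delta>, \<epsilon>, \<Delta>, e)\<close>, with \<open>!\<close> split into \<open>bang\<close> and \<open>bmap\<close>; the second is \<open>(m\<^sub>\<otimes>, m\<^sub>K)\<close> or \<open>(\<nabla>, u)\<close>.
\<close>

type_synonym ('o, 'a) coalgebra_modality_data =
  "('o \<Rightarrow> 'o) \<times> ('a \<Rightarrow> 'a) \<times> ('o \<Rightarrow> 'a) \<times> ('o \<Rightarrow> 'a) \<times> ('o \<Rightarrow> 'a) \<times> ('o \<Rightarrow> 'a)"

type_synonym ('o, 'a) monoidal_data =
  "('o, 'a) coalgebra_modality_data \<times> ('o \<Rightarrow> 'o \<Rightarrow> 'a) \<times> 'a"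

type_synonym ('o, 'a) bialgebra_data =
  "('o, 'a) coalgebra_modality_data \<times> ('o \<Rightarrow> 'a) \<times> ('o \<Rightarrow> 'a)"

definition monoidal_coalgebra_modalities ::
  "('o, 'a) additive_smc_data \<Rightarrow> ('o, 'a) monoidal_data set"
  where "monoidal_coalgebra_modalities X =
    {((bang, bmap, \<delta>, \<epsilon>, \<Delta>, e), (m, mK)) | bang bmap \<delta> \<epsilon> \<Delta> e m mK.
      monoidal_coalgebra_modality X bang bmap \<delta> \<epsilon> \<Delta> e m mK}"

definition additive_bialgebra_modalities ::
  "('o, 'a) additive_smc_data \<Rightarrow> ('o, 'a) bialgebra_data set"
  where "additive_bialgebra_modalities X =
    {((bang, bmap, \<delta>, \<epsilon>, \<Delta>, e), (nabla, u)) | bang bmap \<delta> \<epsilon> \<Delta> e nabla u.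
      additive_bialgebra_modality X bang bmap \<delta> \<epsilon> \<Delta> e nabla u}"

definition additive_linear_category ::
  "('o, 'a) additive_smc_data \<Rightarrow> ('o, 'a) monoidal_data \<Rightarrow> bool"
  where "additive_linear_category X M \<longleftrightarrow>
    additive_smc X \<and> M \<in> monoidal_coalgebra_modalities X"

definition additive_smc_with_additive_bialgebra_modality ::
  "('o, 'a) additive_smc_data \<Rightarrow> ('o, 'a) bialgebra_data \<Rightarrow> bool"
  where "additive_smc_with_additive_bialgebra_modality X N \<longleftrightarrow>
    additive_smc X \<and> N \<in> additive_bialgebra_modalities X"

fun bialgebra_of_monoidal ::
  "('o, 'a) additive_smc_data \<Rightarrow> ('o, 'a) monoidal_data \<Rightarrow> ('o, 'a) bialgebra_data"
  where "bialgebra_of_monoidal X ((bang, bmap, \<delta>, \<epsilon>, \<Delta>, e), (m, mK)) =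
    ((bang, bmap, \<delta>, \<epsilon>, \<Delta>, e),
     (\<lambda>A. (\<delta> A \<otimes>\<^bsub>X\<^esub> \<delta> A) \<cdot>\<^bsub>X\<^esub> m (bang A) (bang A)
            \<cdot>\<^bsub>X\<^esub> bmap ((\<epsilon> A \<otimes>\<^bsub>X\<^esub> e A) \<oplus>\<^bsub>X\<^esub> (e A \<otimes>\<^bsub>X\<^esub> \<epsilon> A)),
      \<lambda>A. mK \<cdot>\<^bsub>X\<^esub> bmap (\<zero>\<^bsub>X\<^esub> \<K>\<^bsub>X\<^esub> A)))"

text \<open>
  In \<open>m\<^sub>K = u \<delta> !(e)\<close> the object at which \<open>u\<close>, \<open>\<delta>\<close>, \<open>e\<close> are taken does not matter, by naturality;
  we take the unit object.
\<close>

fun monoidal_of_bialgebra ::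
  "('o, 'a) additive_smc_data \<Rightarrow> ('o, 'a) bialgebra_data \<Rightarrow> ('o, 'a) monoidal_data"
  where "monoidal_of_bialgebra X ((bang, bmap, \<delta>, \<epsilon>, \<Delta>, e), (nabla, u)) =
    ((bang, bmap, \<delta>, \<epsilon>, \<Delta>, e),
     (\<lambda>A B. (\<delta> A \<otimes>\<^bsub>X\<^esub> \<delta> B)
        \<cdot>\<^bsub>X\<^esub> (bmap (\<one>\<^bsub>X\<^esub> (bang A) \<otimes>\<^bsub>X\<^esub> u B) \<otimes>\<^bsub>X\<^esub> bmap (u A \<otimes>\<^bsub>X\<^esub> \<one>\<^bsub>X\<^esub> (bang B)))
        \<cdot>\<^bsub>X\<^esub> nabla (bang A \<boxtimes>\<^bsub>X\<^esub> bang B)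
        \<cdot>\<^bsub>X\<^esub> \<delta> (bang A \<boxtimes>\<^bsub>X\<^esub> bang B)
        \<cdot>\<^bsub>X\<^esub> bmap (\<Delta> (bang A \<boxtimes>\<^bsub>X\<^esub> bang B))
        \<cdot>\<^bsub>X\<^esub> bmap (bmap (\<epsilon> A \<otimes>\<^bsub>X\<^esub> e B) \<otimes>\<^bsub>X\<^esub> bmap (e A \<otimes>\<^bsub>X\<^esub> \<epsilon> B))
        \<cdot>\<^bsub>X\<^esub> bmap (\<epsilon> A \<otimes>\<^bsub>X\<^esub> \<epsilon> B),
      u \<K>\<^bsub>X\<^esub> \<cdot>\<^bsub>X\<^esub> \<delta> \<K>\<^bsub>X\<^esub> \<cdot>\<^bsub>X\<^esub> bmap (e \<K>\<^bsub>X\<^esub>)))"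

end

theory Submission
  imports Defs
begin

text \<open>
  A map \<open>f\<close> from a \<open>!\<close>-coalgebra \<open>(C, c)\<close> to a cofree one \<open>(!A, \<delta>)\<close> that respects the coalgebra
  structures is determined by \<open>f \<epsilon>\<close>, since \<open>f = c !(f \<epsilon>)\<close>.  Every axiom on either side equates two
  coalgebra maps into a cofree coalgebra, so it suffices to exhibit the coalgebra structures and to
  compare the composites with \<open>\<epsilon>\<close>.

  From a monoidal coalgebra modality, coalgebras are tensored by \<open>(c \<otimes> d) m\<close>.  From an additive
  bialgebra modality, \<open>W = !A \<otimes> !B\<close> is a retract of the cofree coalgebra \<open>!W\<close>, and the idempotent on
  \<open>!W\<close> is a convolution of coalgebra maps; additivity \<open>!(f + g) = \<Delta> (!(f) \<otimes> !(g)) \<nabla>\<close> says precisely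
  that a convolution of coalgebra maps is a coalgebra map.  Hence \<open>W\<close> inherits a coalgebra structure
  \<open>s\<close> and behaves as a product of \<open>!A\<close> and \<open>!B\<close>, and \<open>m = s !(\<epsilon> \<otimes> \<epsilon>)\<close>.
\<close>

section \<open>Strict symmetric monoidal categories and comonoids\<close>

lemma in_hom [simp]: "f \<in> homset X A B \<longleftrightarrow> Dom X f = A \<and> Cod X f = B"
  by (simp add: homset_def)

context smc
begin

lemma ident_type [simp]: "Dom X (\<one> A) = A" "Cod X (\<one> A) = A"
  using ident_hom[of A] by simp_all

lemma seq_type [simp]:
  assumes "Cod X f = Dom X g"
  shows "Dom X (f \<cdot> g) = Dom X f" "Cod X (f \<cdot> g) = Cod X g"
  using seq_hom[of f "Dom X f" "Cod X f" g "Cod X g"] assms by simp_all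

lemma tmap_type [simp]:
  "Dom X (f \<otimes> g) = Dom X f \<boxtimes> Dom X g" "Cod X (f \<otimes> g) = Cod X f \<boxtimes> Cod X g"
  using tmap_hom[of f "Dom X f" "Cod X f" g "Dom X g" "Cod X g"] by simp_all

lemma symm_type [simp]: "Dom X (\<sigma> A B) = A \<boxtimes> B" "Cod X (\<sigma> A B) = B \<boxtimes> A"
  using symm_hom[of A B] by simp_all

lemma ident_comp [simp]: "Dom X f = A \<Longrightarrow> \<one> A \<cdot> f = f"
  using ident_seq[of f A "Cod X f"] by simp

lemma comp_ident [simp]: "Cod X f = A \<Longrightarrow> f \<cdot> \<one> A = f"
  using seq_ident[of f "Dom X f" A] by simp

lemma comp_assoc [simp]:
  "Cod X f = Dom X g \<Longrightarrow> Cod X g = Dom X h \<Longrightarrow> (f \<cdot> g) \<cdot> h = f \<cdot> (g \<cdot> h)"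
  using seq_assoc[of f "Dom X f" "Cod X f" g "Cod X g" h "Cod X h"] by simp

lemma comp_reassoc:
  "f \<cdot> g = h \<Longrightarrow> Cod X f = Dom X g \<Longrightarrow> Cod X g = Dom X x \<Longrightarrow> f \<cdot> (g \<cdot> x) = h \<cdot> x"
  using comp_assoc by metis

lemma comp_ident_reassoc:
  "f \<cdot> g = \<one> A \<Longrightarrow> Cod X f = Dom X g \<Longrightarrow> Cod X g = Dom X x \<Longrightarrow> Dom X f = A \<Longrightarrow> f \<cdot> (g \<cdot> x) = x"
  using comp_reassoc[of f g "\<one> A" x] seq_type(2)[of f g] by simp

lemma tmap_comp:
  "Cod X f = Dom X g \<Longrightarrow> Cod X h = Dom X k \<Longrightarrow> (f \<otimes> h) \<cdot> (g \<otimes> k) = (f \<cdot> g) \<otimes> (h \<cdot> k)"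
  using interchange[of f "Dom X f" "Cod X f" g "Cod X g" h "Dom X h" "Cod X h" k "Cod X k"]
  by simp

lemma tmap_comp_reassoc:
  assumes "Cod X f = Dom X g" "Cod X h = Dom X k" "Cod X g \<boxtimes> Cod X k = Dom X x"
  shows "(f \<otimes> h) \<cdot> ((g \<otimes> k) \<cdot> x) = ((f \<cdot> g) \<otimes> (h \<cdot> k)) \<cdot> x"
  using assms by (intro comp_reassoc tmap_comp) simp_all

declare tobj_assoc [simp] unit_tobj [simp] tobj_unit [simp] unit_tmap [simp] tmap_unit [simp]
  tmap_ident [simp] symm_unit [simp]

lemma symm_unit_left [simp]: "\<sigma> \<K> A = \<one> A"
proof -
  have "\<sigma> \<K> A = \<sigma> \<K> A \<cdot> \<sigma> A \<K>" by simp
  also have "\<dots> = \<one> A" by (simp only: symm_symm unit_tobj)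
  finally show ?thesis .
qed

lemma symm_nat: "Cod X f = B \<Longrightarrow> Cod X g = D \<Longrightarrow>
    (f \<otimes> g) \<cdot> \<sigma> B D = \<sigma> (Dom X f) (Dom X g) \<cdot> (g \<otimes> f)"
  using symm_natural[of f "Dom X f" B g "Dom X g" D] by simp

definition tcomult :: "'a \<Rightarrow> 'a \<Rightarrow> 'a"
  where "tcomult d d' =
    (d \<otimes> d') \<cdot> (\<one> (Dom X d) \<otimes> \<sigma> (Dom X d) (Dom X d') \<otimes> \<one> (Dom X d'))"

definition comon_type :: "'a \<Rightarrow> 'a \<Rightarrow> bool"
  where "comon_type d k \<longleftrightarrow> Cod X d = Dom X d \<boxtimes> Dom X d \<and> Dom X k = Dom X d \<and> Cod X k = \<K>"

definition counital :: "'a \<Rightarrow> 'a \<Rightarrow> bool"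
  where "counital d k \<longleftrightarrow> comon_type d k \<and>
    d \<cdot> (k \<otimes> \<one> (Dom X d)) = \<one> (Dom X d) \<and> d \<cdot> (\<one> (Dom X d) \<otimes> k) = \<one> (Dom X d)"

definition comon_map :: "'a \<Rightarrow> 'a \<Rightarrow> 'a \<Rightarrow> 'a \<Rightarrow> 'a \<Rightarrow> bool"
  where "comon_map d k f d' k' \<longleftrightarrow> comon_type d k \<and> comon_type d' k' \<and> Dom X f = Dom X d \<and> Cod X f = Dom X d' \<and>
    f \<cdot> d' = d \<cdot> (f \<otimes> f) \<and> f \<cdot> k' = k"

lemma tcomult_type:
  assumes "Cod X d = Dom X d \<boxtimes> Dom X d" "Cod X d' = Dom X d' \<boxtimes> Dom X d'"
  shows "Dom X (tcomult d d') = Dom X d \<boxtimes> Dom X d'"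
    "Cod X (tcomult d d') = Dom X d \<boxtimes> Dom X d' \<boxtimes> (Dom X d \<boxtimes> Dom X d')"
  using assms by (simp_all add: tcomult_def)

lemma middle_swap_tmap:
  assumes "Dom X f = A" "Dom X h = B" "Dom X g = C" "Dom X h' = D"
  shows "(\<one> A \<otimes> \<sigma> C B \<otimes> \<one> D) \<cdot> ((f \<otimes> h) \<otimes> (g \<otimes> h'))
    = ((f \<otimes> g) \<otimes> (h \<otimes> h')) \<cdot> (\<one> (Cod X f) \<otimes> \<sigma> (Cod X g) (Cod X h) \<otimes> \<one> (Cod X h'))"
proof -
  have "(\<one> A \<otimes> \<sigma> C B \<otimes> \<one> D) \<cdot> ((f \<otimes> h) \<otimes> (g \<otimes> h'))
      = (\<one> A \<otimes> (\<sigma> C B \<otimes> \<one> D)) \<cdot> (f \<otimes> ((h \<otimes> g) \<otimes> h'))"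
    by (simp only: tmap_assoc)
  also have "\<dots> = f \<otimes> ((\<sigma> C B \<cdot> (h \<otimes> g)) \<otimes> h')"
    using assms by (simp add: tmap_comp)
  also have "\<dots> = f \<otimes> (((g \<otimes> h) \<cdot> \<sigma> (Cod X g) (Cod X h)) \<otimes> h')"
    using assms by (simp add: symm_nat)
  also have "\<dots> = (f \<otimes> ((g \<otimes> h) \<otimes> h')) \<cdot>
      (\<one> (Cod X f) \<otimes> (\<sigma> (Cod X g) (Cod X h) \<otimes> \<one> (Cod X h')))"
    using assms by (simp add: tmap_comp)
  also have "\<dots> = ((f \<otimes> g) \<otimes> (h \<otimes> h')) \<cdot>
      (\<one> (Cod X f) \<otimes> \<sigma> (Cod X g) (Cod X h) \<otimes> \<one> (Cod X h'))"
    by (simp only: tmap_assoc)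
  finally show ?thesis .
qed

lemma tcomult_tmap:
  assumes "Cod X d = Dom X d \<boxtimes> Dom X d" "Cod X d' = Dom X d' \<boxtimes> Dom X d'"
    and "Dom X f = Dom X d" "Dom X g = Dom X d" "Dom X h = Dom X d'" "Dom X h' = Dom X d'"
  shows "tcomult d d' \<cdot> ((f \<otimes> h) \<otimes> (g \<otimes> h')) = ((d \<cdot> (f \<otimes> g)) \<otimes> (d' \<cdot> (h \<otimes> h'))) \<cdot>
    (\<one> (Cod X f) \<otimes> \<sigma> (Cod X g) (Cod X h) \<otimes> \<one> (Cod X h'))"
proof -
  let ?S = "\<one> (Cod X f) \<otimes> \<sigma> (Cod X g) (Cod X h) \<otimes> \<one> (Cod X h')"
  have "tcomult d d' \<cdot> ((f \<otimes> h) \<otimes> (g \<otimes> h'))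
      = (d \<otimes> d') \<cdot> ((\<one> (Dom X d) \<otimes> \<sigma> (Dom X d) (Dom X d') \<otimes> \<one> (Dom X d')) \<cdot>
          ((f \<otimes> h) \<otimes> (g \<otimes> h')))"
    using assms unfolding tcomult_def by (intro comp_assoc) simp_all
  also have "\<dots> = (d \<otimes> d') \<cdot> (((f \<otimes> g) \<otimes> (h \<otimes> h')) \<cdot> ?S)"
    using assms by (subst middle_swap_tmap) simp_all
  also have "\<dots> = ((d \<cdot> (f \<otimes> g)) \<otimes> (d' \<cdot> (h \<otimes> h'))) \<cdot> ?S"
    using assms by (intro tmap_comp_reassoc) simp_all
  finally show ?thesis .
qed

lemma comon_type_tcomult:
  assumes "comon_type d k" "comon_type d' k'"
  shows "comon_type (tcomult d d') (k \<otimes> k')"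
  using assms tcomult_type[of d d'] by (simp add: comon_type_def)

lemma counital_tcomult:
  assumes "counital d k" "counital d' k'"
  shows "counital (tcomult d d') (k \<otimes> k')"
proof -
  note a = assms[unfolded counital_def comon_type_def]
  note t = tcomult_type[of d d']
  have "tcomult d d' \<cdot> ((k \<otimes> k') \<otimes> (\<one> (Dom X d) \<otimes> \<one> (Dom X d'))) = \<one> (Dom X d \<boxtimes> Dom X d')"
    using a by (subst tcomult_tmap) simp_all
  moreover have "tcomult d d' \<cdot> ((\<one> (Dom X d) \<otimes> \<one> (Dom X d')) \<otimes> (k \<otimes> k')) = \<one> (Dom X d \<boxtimes> Dom X d')"
    using a by (subst tcomult_tmap) simp_all
  ultimately show ?thesis using a t by (simp add: counital_def comon_type_def)
qed

lemma tcomult_projections: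
  assumes "counital d k" "counital d' k'"
  shows "tcomult d d' \<cdot> ((\<one> (Dom X d) \<otimes> k') \<otimes> (k \<otimes> \<one> (Dom X d'))) = \<one> (Dom X d \<boxtimes> Dom X d')"
  using assms by (subst tcomult_tmap) (simp_all add: counital_def comon_type_def)

lemma tcomult_pair:
  assumes "counital d k" "counital d' k'" "Dom X f = Dom X d" "Dom X g = Dom X d'"
  shows "tcomult d d' \<cdot> (((\<one> (Dom X d) \<otimes> k') \<cdot> f) \<otimes> ((k \<otimes> \<one> (Dom X d')) \<cdot> g)) = f \<otimes> g"
proof -
  note a = assms[unfolded counital_def comon_type_def]
  note t = tcomult_type[of d d']
  have "tcomult d d' \<cdot> (((\<one> (Dom X d) \<otimes> k') \<cdot> f) \<otimes> ((k \<otimes> \<one> (Dom X d')) \<cdot> g))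
      = tcomult d d' \<cdot> (((\<one> (Dom X d) \<otimes> k') \<otimes> (k \<otimes> \<one> (Dom X d'))) \<cdot> (f \<otimes> g))"
    using a by (subst tmap_comp) simp_all
  also have "\<dots> = f \<otimes> g"
    using a t by (subst comp_reassoc[OF tcomult_projections[OF assms(1,2)]]) simp_all
  finally show ?thesis .
qed

lemma tcomult_symm:
  assumes "counital d k" "counital d' k'"
  shows "tcomult d d' \<cdot> ((k \<otimes> \<one> (Dom X d')) \<otimes> (\<one> (Dom X d) \<otimes> k')) = \<sigma> (Dom X d) (Dom X d')"
  using assms by (subst tcomult_tmap) (simp_all add: counital_def comon_type_def)

lemma comon_map_comp:
  assumes "comon_map d k f d' k'" "comon_map d' k' g d'' k''"
  shows "comon_map d k (f \<cdot> g) d'' k''"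
proof -
  note a = assms[unfolded comon_map_def comon_type_def]
  have "f \<cdot> (g \<cdot> d'') = f \<cdot> (d' \<cdot> (g \<otimes> g))" using a by simp
  also have "\<dots> = (d \<cdot> (f \<otimes> f)) \<cdot> (g \<otimes> g)" using a by (intro comp_reassoc) simp_all
  also have "\<dots> = d \<cdot> ((f \<cdot> g) \<otimes> (f \<cdot> g))" using a by (simp add: tmap_comp)
  finally show ?thesis using a by (simp add: comon_map_def comon_type_def)
qed

lemma comon_map_tmap:
  assumes "comon_map d1 k1 f d2 k2" "comon_map d3 k3 g d4 k4"
  shows "comon_map (tcomult d1 d3) (k1 \<otimes> k3) (f \<otimes> g) (tcomult d2 d4) (k2 \<otimes> k4)"
proof -
  note a = assms[unfolded comon_map_def comon_type_def]
  let ?S = "\<one> (Dom X d2) \<otimes> \<sigma> (Dom X d2) (Dom X d4) \<otimes> \<one> (Dom X d4)"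
  have "(f \<otimes> g) \<cdot> tcomult d2 d4 = ((f \<cdot> d2) \<otimes> (g \<cdot> d4)) \<cdot> ?S"
    using a unfolding tcomult_def by (intro tmap_comp_reassoc trans[OF comp_reassoc[OF tmap_comp]]) simp_all
  also have "\<dots> = tcomult d1 d3 \<cdot> ((f \<otimes> g) \<otimes> (f \<otimes> g))"
    using a by (subst tcomult_tmap) simp_all
  finally show ?thesis using a tcomult_type[of d1 d3] tcomult_type[of d2 d4]
    by (simp add: comon_map_def comon_type_def tmap_comp)
qed

end

section \<open>Coalgebras of a coalgebra modality\<close>

context coalgebra_modality
begin

lemma coalgebra_modality_type [simp]:
  "Dom X (bmap f) = bang (Dom X f)" "Cod X (bmap f) = bang (Cod X f)"
  "Dom X (\<delta> A) = bang A" "Cod X (\<delta> A) = bang (bang A)"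
  "Dom X (\<epsilon> A) = bang A" "Cod X (\<epsilon> A) = A"
  "Dom X (\<Delta> A) = bang A" "Cod X (\<Delta> A) = bang A \<boxtimes> bang A"
  "Dom X (e A) = bang A" "Cod X (e A) = \<K>"
  using bmap_hom[of f "Dom X f" "Cod X f"] delta_hom[of A] eps_hom[of A] Delta_hom[of A] e_hom[of A]
  by simp_all

declare bmap_ident [simp] delta_eps [simp] delta_bmap_eps [simp]
  Delta_counit_left [simp] Delta_counit_right [simp]

lemma bmap_comp: "Cod X f = Dom X g \<Longrightarrow> bmap (f \<cdot> g) = bmap f \<cdot> bmap g"
  using bmap_seq[of f "Dom X f" "Cod X f" g "Cod X g"] by simp

lemma bmap_delta: "Cod X f = B \<Longrightarrow> bmap f \<cdot> \<delta> B = \<delta> (Dom X f) \<cdot> bmap (bmap f)"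
  using delta_natural[of f "Dom X f" B] by simp

lemma bmap_eps: "Cod X f = B \<Longrightarrow> bmap f \<cdot> \<epsilon> B = \<epsilon> (Dom X f) \<cdot> f"
  using eps_natural[of f "Dom X f" B] by simp

lemma bmap_e [simp]: "Cod X f = B \<Longrightarrow> bmap f \<cdot> e B = e (Dom X f)"
  using e_natural[of f "Dom X f" B] by simp

lemma delta_e [simp]: "\<delta> A \<cdot> e (bang A) = e A"
proof -
  have "\<delta> A \<cdot> e (bang A) = \<delta> A \<cdot> (bmap (\<epsilon> A) \<cdot> e A)" by simp
  also have "\<dots> = \<one> (bang A) \<cdot> e A" by (intro comp_reassoc) simp_all
  finally show ?thesis by simp
qed

lemma comon_type_bang: "comon_type (\<Delta> A) (e A)"
  by (simp add: comon_type_def)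

lemma counital_bang: "counital (\<Delta> A) (e A)"
  by (simp add: counital_def comon_type_def)

lemma comon_map_bmap:
  "Dom X f = A \<Longrightarrow> Cod X f = B \<Longrightarrow> comon_map (\<Delta> A) (e A) (bmap f) (\<Delta> B) (e B)"
  using Delta_natural[of f A B] by (simp add: comon_map_def comon_type_def)

lemma comon_map_delta: "comon_map (\<Delta> A) (e A) (\<delta> A) (\<Delta> (bang A)) (e (bang A))"
  by (simp add: comon_map_def comon_type_def delta_Delta)

definition coalg :: "'a \<Rightarrow> bool"
  where "coalg c \<longleftrightarrow> Cod X c = bang (Dom X c) \<and> c \<cdot> \<epsilon> (Dom X c) = \<one> (Dom X c) \<and>
    c \<cdot> \<delta> (Dom X c) = c \<cdot> bmap c"

definition coalg_map :: "'a \<Rightarrow> 'a \<Rightarrow> 'a \<Rightarrow> bool"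
  where "coalg_map c f c' \<longleftrightarrow> coalg c \<and> coalg c' \<and> Dom X f = Dom X c \<and> Cod X f = Dom X c' \<and>
    f \<cdot> c' = c \<cdot> bmap f"

lemma coalg_delta: "coalg (\<delta> A)"
  by (simp add: coalg_def delta_delta)

lemma coalg_map_comp:
  assumes "coalg_map c f c'" "coalg_map c' g c''"
  shows "coalg_map c (f \<cdot> g) c''"
proof -
  note a = assms[unfolded coalg_map_def coalg_def]
  have "f \<cdot> (g \<cdot> c'') = f \<cdot> (c' \<cdot> bmap g)" using a by simp
  also have "\<dots> = (c \<cdot> bmap f) \<cdot> bmap g" using a by (intro comp_reassoc) simp_all
  also have "\<dots> = c \<cdot> bmap (f \<cdot> g)" using a by (simp add: bmap_comp)
  finally show ?thesis using assms a by (simp add: coalg_map_def)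
qed

lemma coalg_map_ident: "coalg c \<Longrightarrow> Dom X c = A \<Longrightarrow> coalg_map c (\<one> A) c"
  by (auto simp: coalg_map_def coalg_def)

lemma coalg_map_bmap:
  "Dom X f = A \<Longrightarrow> Cod X f = B \<Longrightarrow> coalg_map (\<delta> A) (bmap f) (\<delta> B)"
  by (simp add: coalg_map_def coalg_delta bmap_delta)

lemma coalg_map_self: "coalg c \<Longrightarrow> Dom X c = A \<Longrightarrow> coalg_map c c (\<delta> A)"
  by (simp add: coalg_map_def coalg_delta) (simp add: coalg_def)

lemma coalg_map_delta: "coalg_map (\<delta> A) (\<delta> A) (\<delta> (bang A))"
  by (intro coalg_map_self coalg_delta) simp

lemma coalg_map_lift:
  assumes "coalg c" "Dom X f = Dom X c" "Cod X f = A"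
  shows "coalg_map c (c \<cdot> bmap f) (\<delta> A)"
  using assms by (intro coalg_map_comp[OF coalg_map_self coalg_map_bmap]) simp_all

lemma lift_eps: "coalg c \<Longrightarrow> Dom X f = Dom X c \<Longrightarrow> Cod X f = A \<Longrightarrow> c \<cdot> bmap f \<cdot> \<epsilon> A = f"
  by (simp add: coalg_def bmap_eps comp_ident_reassoc)

lemma coalg_map_eq_lift:
  assumes "coalg_map c f (\<delta> A)"
  shows "f = c \<cdot> bmap (f \<cdot> \<epsilon> A)"
proof -
  note a = assms[unfolded coalg_map_def coalg_def]
  have "f = f \<cdot> (\<delta> A \<cdot> bmap (\<epsilon> A))" using a by simp
  also have "\<dots> = (c \<cdot> bmap f) \<cdot> bmap (\<epsilon> A)" using a by (intro comp_reassoc) simp_all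
  also have "\<dots> = c \<cdot> bmap (f \<cdot> \<epsilon> A)" using a by (simp add: bmap_comp)
  finally show ?thesis .
qed

lemma coalg_map_eqI:
  assumes "coalg_map c f (\<delta> A)" "coalg_map c g (\<delta> A)" "f \<cdot> \<epsilon> A = g \<cdot> \<epsilon> A"
  shows "f = g"
  using assms coalg_map_eq_lift by metis

lemma coalg_retract:
  assumes c: "coalg c" and q: "coalg_map c (r \<cdot> z) c"
    and "Dom X z = W" "Cod X z = Dom X c" "Dom X r = Dom X c" "Cod X r = W"
    and zr: "z \<cdot> r = \<one> W"
  defines "s \<equiv> z \<cdot> c \<cdot> bmap r"
  shows "coalg s" "coalg_map s z c" "coalg_map c r s"
proof -
  note a = assms(3-6)
  have [simp]: "Cod X c = bang (Dom X c)" using c by (simp add: coalg_def)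
  have rzc: "r \<cdot> z \<cdot> c = c \<cdot> bmap (r \<cdot> z)" using q by (simp add: coalg_map_def)
  have sz: "s \<cdot> bmap z = z \<cdot> c"
  proof -
    have "s \<cdot> bmap z = z \<cdot> (r \<cdot> z \<cdot> c)" using a by (simp add: s_def rzc bmap_comp)
    also have "\<dots> = z \<cdot> c" using a zr by (simp add: comp_ident_reassoc)
    finally show ?thesis .
  qed
  have rs: "r \<cdot> s = c \<cdot> bmap r"
  proof -
    have "r \<cdot> s = (r \<cdot> z \<cdot> c) \<cdot> bmap r" using a by (simp add: s_def)
    also have "\<dots> = c \<cdot> bmap (r \<cdot> (z \<cdot> r))" using a by (simp only: rzc) (simp add: bmap_comp)
    finally show ?thesis using a by (simp add: zr)
  qed
  have "s \<cdot> \<epsilon> W = z \<cdot> (c \<cdot> \<epsilon> (Dom X c)) \<cdot> r" using a by (simp add: s_def bmap_eps)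
  also have "\<dots> = \<one> W" using a c zr by (simp add: coalg_def)
  finally have s_eps: "s \<cdot> \<epsilon> W = \<one> W" .
  have "s \<cdot> \<delta> W = z \<cdot> (c \<cdot> \<delta> (Dom X c)) \<cdot> bmap (bmap r)"
    using a by (simp add: s_def bmap_delta)
  also have "\<dots> = z \<cdot> (c \<cdot> bmap (c \<cdot> bmap r))"
    using a c by (simp add: coalg_def bmap_comp)
  also have "\<dots> = s \<cdot> bmap s"
    using a by (simp add: rs[symmetric]) (simp add: s_def bmap_comp)
  finally show s: "coalg s" using a s_eps by (simp add: coalg_def) (simp add: s_def)
  show "coalg_map s z c" "coalg_map c r s"
    using a s c sz rs by (simp_all add: coalg_map_def) (simp_all add: s_def)
qed

definition comon_coalg :: "'a \<Rightarrow> 'a \<Rightarrow> 'a \<Rightarrow> bool"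
  where "comon_coalg c d k \<longleftrightarrow> coalg c \<and> counital d k \<and>
    comon_map d k c (\<Delta> (Dom X c)) (e (Dom X c))"

lemma comon_coalg_delta: "comon_coalg (\<delta> A) (\<Delta> A) (e A)"
  by (simp add: comon_coalg_def coalg_delta counital_bang comon_map_delta)

end

section \<open>Additive structure\<close>

context additive_smc
begin

lemma madd_type [simp]:
  assumes "Dom X g = Dom X f" "Cod X g = Cod X f"
  shows "Dom X (f \<oplus> g) = Dom X f" "Cod X (f \<oplus> g) = Cod X f"
  using madd_hom[of f "Dom X f" "Cod X f" g] assms by simp_all

lemma mzero_type [simp]: "Dom X (\<zero> A B) = A" "Cod X (\<zero> A B) = B"
  using mzero_hom[of A B] by simp_all

lemma comp_madd:
  assumes "Dom X g = Cod X f" "Dom X h = Cod X f" "Cod X g = Cod X h"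
  shows "f \<cdot> (g \<oplus> h) = (f \<cdot> g) \<oplus> (f \<cdot> h)"
  using seq_madd[of f "Dom X f" "Cod X f" g "Cod X g" h] assms by simp

lemma madd_comp:
  assumes "Cod X f = Dom X h" "Cod X g = Dom X h" "Dom X f = Dom X g"
  shows "(f \<oplus> g) \<cdot> h = (f \<cdot> h) \<oplus> (g \<cdot> h)"
  using madd_seq[of f "Dom X f" "Cod X f" g h "Cod X h"] assms by simp

lemma tmap_distrib_left:
  "Dom X g = Dom X h \<Longrightarrow> Cod X g = Cod X h \<Longrightarrow> f \<otimes> (g \<oplus> h) = (f \<otimes> g) \<oplus> (f \<otimes> h)"
  using tmap_madd[of f "Dom X f" "Cod X f" g "Dom X h" "Cod X h" h] by simp

lemma tmap_distrib_right:
  "Dom X f = Dom X g \<Longrightarrow> Cod X f = Cod X g \<Longrightarrow> (f \<oplus> g) \<otimes> h = (f \<otimes> h) \<oplus> (g \<otimes> h)"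
  using madd_tmap[of f "Dom X g" "Cod X g" g h "Dom X h" "Cod X h"] by simp

lemma comp_mzero [simp]: "Cod X f = B \<Longrightarrow> f \<cdot> \<zero> B C = \<zero> (Dom X f) C"
  using seq_mzero[of f "Dom X f" B C] by simp

lemma mzero_comp [simp]: "Dom X f = B \<Longrightarrow> \<zero> A B \<cdot> f = \<zero> A (Cod X f)"
  using mzero_seq[of f B "Cod X f" A] by simp

lemma tmap_zero [simp]:
  "f \<otimes> \<zero> C D = \<zero> (Dom X f \<boxtimes> C) (Cod X f \<boxtimes> D)" "\<zero> C D \<otimes> f = \<zero> (C \<boxtimes> Dom X f) (D \<boxtimes> Cod X f)"
  using tmap_mzero[of f "Dom X f" "Cod X f" C D] mzero_tmap[of f "Dom X f" "Cod X f" C D] by simp_all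

lemma mzero_left [simp]: "Dom X f = A \<Longrightarrow> Cod X f = B \<Longrightarrow> \<zero> A B \<oplus> f = f"
  using mzero_madd[of f A B] by simp

lemma mzero_right [simp]: "Dom X f = A \<Longrightarrow> Cod X f = B \<Longrightarrow> f \<oplus> \<zero> A B = f"
  using madd_commute[of f A B "\<zero> A B"] by simp

end

section \<open>From additive bialgebra modalities to monoidal coalgebra modalities\<close>

context additive_bialgebra_modality
begin

lemma bialgebra_modality_type [simp]:
  "Dom X (nabla A) = bang A \<boxtimes> bang A" "Cod X (nabla A) = bang A"
  "Dom X (u A) = \<K>" "Cod X (u A) = bang A"
  using nabla_hom[of A] u_hom[of A] by simp_all

lemma u_bmap [simp]: "Dom X f = A \<Longrightarrow> u A \<cdot> bmap f = u (Cod X f)"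
  using u_natural[of f A "Cod X f"] by simp

lemma nabla_bmap: "Dom X f = A \<Longrightarrow> nabla A \<cdot> bmap f = (bmap f \<otimes> bmap f) \<cdot> nabla (Cod X f)"
  using nabla_natural[of f A "Cod X f"] by simp

lemma u_eps [simp]: "u A \<cdot> \<epsilon> A = \<zero> \<K> A"
proof -
  have "u A \<cdot> \<epsilon> A = (u A \<cdot> bmap (\<zero> A A)) \<cdot> \<epsilon> A" by (subst u_bmap) simp_all
  also have "\<dots> = \<zero> \<K> A" by (simp del: u_bmap add: bmap_eps)
  finally show ?thesis .
qed

lemma comon_map_nabla: "comon_map (tcomult (\<Delta> A) (\<Delta> A)) (e A \<otimes> e A) (nabla A) (\<Delta> A) (e A)"
  using nabla_Delta[of A] comon_type_bang[of A]
  by (simp add: comon_map_def comon_type_tcomult nabla_e) (simp add: tcomult_def)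

lemma comon_map_u: "comon_map (\<one> \<K>) (\<one> \<K>) (u A) (\<Delta> A) (e A)"
  by (simp add: comon_map_def comon_type_def u_Delta u_e)

lemma coalg_map_conv:
  assumes c: "comon_coalg c d k" and f: "coalg_map c f (\<delta> A)" and g: "coalg_map c g (\<delta> A)"
  shows "coalg_map c (d \<cdot> (f \<otimes> g) \<cdot> nabla A) (\<delta> A)"
proof -
  note a = c[unfolded comon_coalg_def coalg_def comon_map_def comon_type_def]
    f[unfolded coalg_map_def] g[unfolded coalg_map_def]
  have dc: "d \<cdot> (c \<otimes> c) = c \<cdot> \<Delta> (Dom X c)"
    using c unfolding comon_coalg_def comon_map_def by metis
  define f' g' where "f' = f \<cdot> \<epsilon> A" and "g' = g \<cdot> \<epsilon> A"
  have [simp]: "Dom X f' = Dom X c" "Cod X f' = A" "Dom X g' = Dom X c" "Cod X g' = A"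
    using a by (simp_all add: f'_def g'_def)
  have "d \<cdot> (f \<otimes> g) = d \<cdot> ((c \<cdot> bmap f') \<otimes> (c \<cdot> bmap g'))"
    using coalg_map_eq_lift[OF f] coalg_map_eq_lift[OF g] by (simp add: f'_def g'_def)
  also have "\<dots> = d \<cdot> ((c \<otimes> c) \<cdot> (bmap f' \<otimes> bmap g'))"
    using a by (simp add: tmap_comp)
  also have "\<dots> = (c \<cdot> \<Delta> (Dom X c)) \<cdot> (bmap f' \<otimes> bmap g')"
    using a by (intro comp_reassoc[OF dc]) simp_all
  finally have "d \<cdot> (f \<otimes> g) \<cdot> nabla A = c \<cdot> (\<Delta> (Dom X c) \<cdot> (bmap f' \<otimes> bmap g') \<cdot> nabla A)"
    using a by simp
  also have "\<dots> = c \<cdot> bmap (f' \<oplus> g')"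
    using bmap_madd[of f' "Dom X c" A g'] by simp
  finally show ?thesis
    using coalg_map_lift[of c "f' \<oplus> g'" A] c by (simp add: comon_coalg_def)
qed

text \<open>
  In the presence of biproducts, \<open>merge\<close> and \<open>split\<close> would be the Seely isomorphisms between
  \<open>!A \<otimes> !B\<close> and \<open>!(A \<oplus> B)\<close>.  Here the object \<open>!A \<otimes> !B\<close> stands in for \<open>A \<oplus> B\<close>: it has projections
  \<open>\<epsilon> \<otimes> e\<close> and \<open>e \<otimes> \<epsilon>\<close>, but injections only out of \<open>!A\<close> and \<open>!B\<close>, and one composite is merely
  idempotent.
\<close>

definition "inj0 A B = \<delta> A \<cdot> bmap (\<one> (bang A) \<otimes> u B)"

definition "inj1 A B = \<delta> B \<cdot> bmap (u A \<otimes> \<one> (bang B))"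

definition "merge A B = (inj0 A B \<otimes> inj1 A B) \<cdot> nabla (bang A \<boxtimes> bang B)"

definition "split A B = \<Delta> (bang A \<boxtimes> bang B) \<cdot> (bmap (\<epsilon> A \<otimes> e B) \<otimes> bmap (e A \<otimes> \<epsilon> B))"

definition "tensor_coalg A B = merge A B \<cdot> \<delta> (bang A \<boxtimes> bang B) \<cdot> bmap (split A B)"

lemma product_type [simp]:
  "Dom X (inj0 A B) = bang A" "Cod X (inj0 A B) = bang (bang A \<boxtimes> bang B)"
  "Dom X (inj1 A B) = bang B" "Cod X (inj1 A B) = bang (bang A \<boxtimes> bang B)"
  "Dom X (merge A B) = bang A \<boxtimes> bang B" "Cod X (merge A B) = bang (bang A \<boxtimes> bang B)"
  "Dom X (split A B) = bang (bang A \<boxtimes> bang B)" "Cod X (split A B) = bang A \<boxtimes> bang B"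
  "Dom X (tensor_coalg A B) = bang A \<boxtimes> bang B"
  "Cod X (tensor_coalg A B) = bang (bang A \<boxtimes> bang B)"
  by (simp_all add: inj0_def inj1_def merge_def split_def tensor_coalg_def)

lemma coalg_map_inj0: "coalg_map (\<delta> A) (inj0 A B) (\<delta> (bang A \<boxtimes> bang B))"
  unfolding inj0_def by (intro coalg_map_lift coalg_delta) simp_all

lemma coalg_map_inj1: "coalg_map (\<delta> B) (inj1 A B) (\<delta> (bang A \<boxtimes> bang B))"
  unfolding inj1_def by (intro coalg_map_lift coalg_delta) simp_all

lemma comon_map_merge:
  "comon_map (tcomult (\<Delta> A) (\<Delta> B)) (e A \<otimes> e B) (merge A B)
    (\<Delta> (bang A \<boxtimes> bang B)) (e (bang A \<boxtimes> bang B))"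
  unfolding merge_def inj0_def inj1_def
  by (intro comon_map_comp[OF comon_map_tmap comon_map_nabla]
      comon_map_comp[OF comon_map_delta comon_map_bmap]) simp_all

lemma delta_bmap_zero: "\<delta> A \<cdot> bmap (\<zero> (bang A) B) = e A \<cdot> u B"
proof -
  have "\<delta> A \<cdot> (e (bang A) \<cdot> u B) = e A \<cdot> u B" by (intro comp_reassoc) simp_all
  then show ?thesis by (simp add: bmap_mzero)
qed

lemma inj0_proj:
  "inj0 A B \<cdot> bmap (\<epsilon> A \<otimes> e B) = \<one> (bang A)"
  "inj0 A B \<cdot> bmap (e A \<otimes> \<epsilon> B) = e A \<cdot> u B"
  by (simp_all add: inj0_def bmap_comp[symmetric] tmap_comp u_e delta_bmap_zero)

lemma inj1_proj:
  "inj1 A B \<cdot> bmap (e A \<otimes> \<epsilon> B) = \<one> (bang B)"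
  "inj1 A B \<cdot> bmap (\<epsilon> A \<otimes> e B) = e B \<cdot> u A"
  by (simp_all add: inj1_def bmap_comp[symmetric] tmap_comp u_e delta_bmap_zero)

lemma merge_proj0: "merge A B \<cdot> bmap (\<epsilon> A \<otimes> e B) = \<one> (bang A) \<otimes> e B"
proof -
  have "merge A B \<cdot> bmap (\<epsilon> A \<otimes> e B)
      = (inj0 A B \<otimes> inj1 A B) \<cdot> ((bmap (\<epsilon> A \<otimes> e B) \<otimes> bmap (\<epsilon> A \<otimes> e B)) \<cdot> nabla A)"
    by (simp add: merge_def nabla_bmap)
  also have "\<dots> = (\<one> (bang A) \<otimes> (e B \<cdot> u A)) \<cdot> nabla A"
    by (simp add: tmap_comp_reassoc inj0_proj inj1_proj)
  also have "\<dots> = ((\<one> (bang A) \<otimes> e B) \<cdot> (\<one> (bang A) \<otimes> u A)) \<cdot> nabla A"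
    by (subst tmap_comp) simp_all
  also have "\<dots> = \<one> (bang A) \<otimes> e B" by (simp add: nabla_unit_right)
  finally show ?thesis .
qed

lemma merge_proj1: "merge A B \<cdot> bmap (e A \<otimes> \<epsilon> B) = e A \<otimes> \<one> (bang B)"
proof -
  have "merge A B \<cdot> bmap (e A \<otimes> \<epsilon> B)
      = (inj0 A B \<otimes> inj1 A B) \<cdot> ((bmap (e A \<otimes> \<epsilon> B) \<otimes> bmap (e A \<otimes> \<epsilon> B)) \<cdot> nabla B)"
    by (simp add: merge_def nabla_bmap)
  also have "\<dots> = ((e A \<cdot> u B) \<otimes> \<one> (bang B)) \<cdot> nabla B"
    by (simp add: tmap_comp_reassoc inj0_proj inj1_proj)
  also have "\<dots> = ((e A \<otimes> \<one> (bang B)) \<cdot> (u B \<otimes> \<one> (bang B))) \<cdot> nabla B"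
    by (subst tmap_comp) simp_all
  also have "\<dots> = e A \<otimes> \<one> (bang B)" by (simp add: nabla_unit_left)
  finally show ?thesis .
qed

lemma merge_split: "merge A B \<cdot> split A B = \<one> (bang A \<boxtimes> bang B)"
proof -
  have "merge A B \<cdot> split A B = (merge A B \<cdot> \<Delta> (bang A \<boxtimes> bang B)) \<cdot>
      (bmap (\<epsilon> A \<otimes> e B) \<otimes> bmap (e A \<otimes> \<epsilon> B))"
    by (simp add: split_def)
  also have "\<dots> = tcomult (\<Delta> A) (\<Delta> B) \<cdot> ((\<one> (bang A) \<otimes> e B) \<otimes> (e A \<otimes> \<one> (bang B)))"
    using comon_map_merge[of A B] tcomult_type[of "\<Delta> A" "\<Delta> B"]
    by (simp add: comon_map_def tmap_comp merge_proj0 merge_proj1)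
  also have "\<dots> = \<one> (bang A \<boxtimes> bang B)"
    using tcomult_projections[OF counital_bang[of A] counital_bang[of B]] by simp
  finally show ?thesis .
qed

lemma coalg_map_split_merge:
  "coalg_map (\<delta> (bang A \<boxtimes> bang B)) (split A B \<cdot> merge A B) (\<delta> (bang A \<boxtimes> bang B))"
proof -
  let ?f = "bmap (\<epsilon> A \<otimes> e B) \<cdot> inj0 A B" and ?g = "bmap (e A \<otimes> \<epsilon> B) \<cdot> inj1 A B"
  have "split A B \<cdot> merge A B = \<Delta> (bang A \<boxtimes> bang B) \<cdot> (?f \<otimes> ?g) \<cdot> nabla (bang A \<boxtimes> bang B)"
    by (simp add: split_def merge_def tmap_comp_reassoc)
  moreover have "coalg_map (\<delta> (bang A \<boxtimes> bang B)) ?f (\<delta> (bang A \<boxtimes> bang B))"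
    by (intro coalg_map_comp[OF coalg_map_bmap coalg_map_inj0]) simp_all
  moreover have "coalg_map (\<delta> (bang A \<boxtimes> bang B)) ?g (\<delta> (bang A \<boxtimes> bang B))"
    by (intro coalg_map_comp[OF coalg_map_bmap coalg_map_inj1]) simp_all
  ultimately show ?thesis using coalg_map_conv[OF comon_coalg_delta] by metis
qed

lemma coalg_tensor: "coalg (tensor_coalg A B)"
  and coalg_map_merge: "coalg_map (tensor_coalg A B) (merge A B) (\<delta> (bang A \<boxtimes> bang B))"
  and coalg_map_split: "coalg_map (\<delta> (bang A \<boxtimes> bang B)) (split A B) (tensor_coalg A B)"
  using coalg_retract[OF coalg_delta coalg_map_split_merge _ _ _ _ merge_split]
  by (simp_all add: tensor_coalg_def)

lemma coalg_map_proj0: "coalg_map (tensor_coalg A B) (\<one> (bang A) \<otimes> e B) (\<delta> A)"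
  unfolding merge_proj0[symmetric]
  by (intro coalg_map_comp[OF coalg_map_merge coalg_map_bmap]) simp_all

lemma coalg_map_proj1: "coalg_map (tensor_coalg A B) (e A \<otimes> \<one> (bang B)) (\<delta> B)"
  unfolding merge_proj1[symmetric]
  by (intro coalg_map_comp[OF coalg_map_merge coalg_map_bmap]) simp_all

lemma comon_coalg_tensor:
  "comon_coalg (tensor_coalg A B) (tcomult (\<Delta> A) (\<Delta> B)) (e A \<otimes> e B)"
proof -
  have "comon_map (tcomult (\<Delta> A) (\<Delta> B)) (e A \<otimes> e B) (tensor_coalg A B)
      (\<Delta> (bang A \<boxtimes> bang B)) (e (bang A \<boxtimes> bang B))"
    unfolding tensor_coalg_def
    by (intro comon_map_comp[OF comon_map_comp[OF comon_map_merge comon_map_delta] comon_map_bmap])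
      simp_all
  then show ?thesis
    by (simp add: comon_coalg_def coalg_tensor counital_tcomult counital_bang)
qed

lemma coalg_map_pair:
  assumes c: "comon_coalg c d k" and f: "coalg_map c f (\<delta> A)" and g: "coalg_map c g (\<delta> B)"
  shows "coalg_map c (d \<cdot> (f \<otimes> g)) (tensor_coalg A B)"
proof -
  note a = c[unfolded comon_coalg_def counital_def comon_type_def]
    f[unfolded coalg_map_def] g[unfolded coalg_map_def]
  have Domd: "Dom X d = Dom X c" using c by (simp add: comon_coalg_def comon_map_def)
  let ?h = "d \<cdot> ((f \<cdot> inj0 A B) \<otimes> (g \<cdot> inj1 A B)) \<cdot> nabla (bang A \<boxtimes> bang B)"
  have "coalg_map c (?h \<cdot> split A B) (tensor_coalg A B)"
    using c f g by (intro coalg_map_comp[OF coalg_map_conv coalg_map_split]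
        coalg_map_comp[OF _ coalg_map_inj0] coalg_map_comp[OF _ coalg_map_inj1])
  moreover have "?h = d \<cdot> (f \<otimes> g) \<cdot> merge A B"
    using a Domd by (simp add: merge_def tmap_comp_reassoc)
  then have "?h \<cdot> split A B = d \<cdot> (f \<otimes> g) \<cdot> (merge A B \<cdot> split A B)"
    using a Domd by simp
  ultimately show ?thesis using a Domd by (simp add: merge_split)
qed

lemma coalg_map_tmap:
  assumes "coalg_map (\<delta> A) f (\<delta> A')" "coalg_map (\<delta> B) g (\<delta> B')"
  shows "coalg_map (tensor_coalg A B) (f \<otimes> g) (tensor_coalg A' B')"
  using coalg_map_pair[OF comon_coalg_tensor coalg_map_comp[OF coalg_map_proj0 assms(1)]
      coalg_map_comp[OF coalg_map_proj1 assms(2)]]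
    tcomult_pair[OF counital_bang[of A] counital_bang[of B], of f g] assms
  by (simp add: coalg_map_def)

definition "triple_coalg A B C = (merge A B \<otimes> \<one> (bang C)) \<cdot>
  tensor_coalg (bang A \<boxtimes> bang B) C \<cdot> bmap (split A B \<otimes> \<one> (bang C))"

lemma triple_type [simp]:
  "Dom X (triple_coalg A B C) = bang A \<boxtimes> (bang B \<boxtimes> bang C)"
  "Cod X (triple_coalg A B C) = bang (bang A \<boxtimes> (bang B \<boxtimes> bang C))"
  by (simp_all add: triple_coalg_def)

lemma coalg_triple: "coalg (triple_coalg A B C)"
  and coalg_map_triple_merge:
    "coalg_map (triple_coalg A B C) (merge A B \<otimes> \<one> (bang C)) (tensor_coalg (bang A \<boxtimes> bang B) C)"
proof -
  have "coalg_map (tensor_coalg (bang A \<boxtimes> bang B) C)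
      ((split A B \<cdot> merge A B) \<otimes> \<one> (bang C)) (tensor_coalg (bang A \<boxtimes> bang B) C)"
    by (intro coalg_map_tmap coalg_map_split_merge coalg_map_ident coalg_delta) simp
  then have q: "coalg_map (tensor_coalg (bang A \<boxtimes> bang B) C)
      ((split A B \<otimes> \<one> (bang C)) \<cdot> (merge A B \<otimes> \<one> (bang C))) (tensor_coalg (bang A \<boxtimes> bang B) C)"
    by (simp add: tmap_comp)
  have zr: "(merge A B \<otimes> \<one> (bang C)) \<cdot> (split A B \<otimes> \<one> (bang C)) = \<one> (bang A \<boxtimes> (bang B \<boxtimes> bang C))"
    by (simp add: tmap_comp merge_split)
  show "coalg (triple_coalg A B C)"
    "coalg_map (triple_coalg A B C) (merge A B \<otimes> \<one> (bang C)) (tensor_coalg (bang A \<boxtimes> bang B) C)"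
    using coalg_retract[OF coalg_tensor q _ _ _ _ zr] by (simp_all add: triple_coalg_def)
qed

lemma comon_coalg_triple:
  "comon_coalg (triple_coalg A B C) (tcomult (tcomult (\<Delta> A) (\<Delta> B)) (\<Delta> C)) ((e A \<otimes> e B) \<otimes> e C)"
proof -
  have "comon_map (\<Delta> C) (e C) (\<one> (bang C)) (\<Delta> C) (e C)"
    using comon_map_bmap[of "\<one> C" C C] by simp
  moreover have "comon_map (tcomult (\<Delta> (bang A \<boxtimes> bang B)) (\<Delta> C)) (e (bang A \<boxtimes> bang B) \<otimes> e C)
      (tensor_coalg (bang A \<boxtimes> bang B) C)
      (\<Delta> (bang (bang A \<boxtimes> bang B) \<boxtimes> bang C)) (e (bang (bang A \<boxtimes> bang B) \<boxtimes> bang C))"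
    using comon_coalg_tensor[of "bang A \<boxtimes> bang B" C] by (simp add: comon_coalg_def)
  ultimately have "comon_map (tcomult (tcomult (\<Delta> A) (\<Delta> B)) (\<Delta> C)) ((e A \<otimes> e B) \<otimes> e C)
      (triple_coalg A B C) (\<Delta> (bang A \<boxtimes> (bang B \<boxtimes> bang C))) (e (bang A \<boxtimes> (bang B \<boxtimes> bang C)))"
    unfolding triple_coalg_def
    by (intro comon_map_comp[OF comon_map_comp[OF comon_map_tmap[OF comon_map_merge]] comon_map_bmap])
      simp_all
  then show ?thesis
    by (simp only: comon_coalg_def coalg_triple counital_tcomult counital_bang triple_type)
qed

lemma coalg_map_triple_tmap:
  assumes f: "coalg_map (tensor_coalg A B) f (\<delta> A')" and g: "coalg_map (\<delta> C) g (\<delta> B')"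
  shows "coalg_map (triple_coalg A B C) (f \<otimes> g) (tensor_coalg A' B')"
proof -
  let ?W = "bang A \<boxtimes> bang B" and ?t = "triple_coalg A B C"
  have "coalg_map ?t ((merge A B \<otimes> \<one> (bang C)) \<cdot> (\<one> (bang ?W) \<otimes> e C) \<cdot> split A B) (tensor_coalg A B)"
    by (intro coalg_map_comp[OF coalg_map_comp[OF coalg_map_triple_merge coalg_map_proj0] coalg_map_split])
  moreover have "(merge A B \<otimes> \<one> (bang C)) \<cdot> (\<one> (bang ?W) \<otimes> e C) \<cdot> split A B = \<one> ?W \<otimes> e C"
  proof -
    have "(merge A B \<otimes> \<one> (bang C)) \<cdot> (\<one> (bang ?W) \<otimes> e C) \<cdot> split A B
        = (merge A B \<otimes> e C) \<cdot> (split A B \<otimes> \<one> \<K>)"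
      by (simp add: tmap_comp)
    also have "\<dots> = \<one> ?W \<otimes> e C" by (subst tmap_comp) (simp_all add: merge_split)
    finally show ?thesis .
  qed
  ultimately have P: "coalg_map ?t (\<one> ?W \<otimes> e C) (tensor_coalg A B)" by simp
  have "coalg_map ?t ((merge A B \<otimes> \<one> (bang C)) \<cdot> (e ?W \<otimes> \<one> (bang C))) (\<delta> C)"
    by (intro coalg_map_comp[OF coalg_map_triple_merge coalg_map_proj1])
  moreover have "merge A B \<cdot> e ?W = e A \<otimes> e B"
    using comon_map_merge[of A B] unfolding comon_map_def by metis
  ultimately have Q: "coalg_map ?t ((e A \<otimes> e B) \<otimes> \<one> (bang C)) (\<delta> C)"
    by (simp add: tmap_comp)
  have "coalg_map ?t (tcomult (tcomult (\<Delta> A) (\<Delta> B)) (\<Delta> C) \<cdot>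
      (((\<one> ?W \<otimes> e C) \<cdot> f) \<otimes> (((e A \<otimes> e B) \<otimes> \<one> (bang C)) \<cdot> g))) (tensor_coalg A' B')"
    by (intro coalg_map_pair[OF comon_coalg_triple] coalg_map_comp[OF P f] coalg_map_comp[OF Q g])
  then show ?thesis
    using tcomult_pair[OF counital_tcomult[OF counital_bang[of A] counital_bang[of B]] counital_bang[of C], of f g]
      assms tcomult_type[of "\<Delta> A" "\<Delta> B"]
    by (simp add: coalg_map_def)
qed

lemma coalg_map_triple_right:
  assumes g: "coalg_map (tensor_coalg B C) g (\<delta> D)"
  shows "coalg_map (triple_coalg A B C) (\<one> (bang A) \<otimes> g) (tensor_coalg A D)"
proof -
  let ?W = "bang A \<boxtimes> bang B" and ?t = "triple_coalg A B C"
  let ?d = "tcomult (tcomult (\<Delta> A) (\<Delta> B)) (\<Delta> C)"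
  let ?f = "\<one> (bang A) \<otimes> e B" and ?h = "(e A \<otimes> \<one> (bang B)) \<otimes> \<one> (bang C)"
  have [simp]: "Dom X g = bang B \<boxtimes> bang C" "Cod X g = bang D"
    using g by (simp_all add: coalg_map_def)
  have "coalg_map ?t ?h (tensor_coalg B C)"
    by (intro coalg_map_triple_tmap coalg_map_proj1 coalg_map_ident coalg_delta) simp
  then have h: "coalg_map ?t (?h \<cdot> g) (\<delta> D)" using g by (rule coalg_map_comp)
  have "coalg_map ?t ((?f \<otimes> \<one> (bang C)) \<cdot> (\<one> (bang A) \<otimes> e C)) (\<delta> A)"
    by (intro coalg_map_comp[OF coalg_map_triple_tmap coalg_map_proj0] coalg_map_proj0
        coalg_map_ident coalg_delta) simp
  moreover have "(?f \<otimes> \<one> (bang C)) \<cdot> (\<one> (bang A) \<otimes> e C) = ?f \<otimes> e C"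
    by (subst tmap_comp) simp_all
  ultimately have "coalg_map ?t (?f \<otimes> e C) (\<delta> A)" by simp
  from coalg_map_pair[OF comon_coalg_triple this h]
  have "coalg_map ?t (?d \<cdot> ((?f \<otimes> e C) \<otimes> (?h \<cdot> g))) (tensor_coalg A D)" .
  moreover have "?d \<cdot> ((?f \<otimes> e C) \<otimes> (?h \<cdot> g)) = \<one> (bang A) \<otimes> g"
  proof -
    have t: "Dom X (tcomult (\<Delta> A) (\<Delta> B)) = ?W" "Cod X (tcomult (\<Delta> A) (\<Delta> B)) = ?W \<boxtimes> ?W"
      using tcomult_type[of "\<Delta> A" "\<Delta> B"] by simp_all
    have 1: "?d \<cdot> ((?f \<otimes> e C) \<otimes> ?h) = \<one> (?W \<boxtimes> bang C)"
      using t tcomult_projections[OF counital_bang[of A] counital_bang[of B]]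
      by (subst tcomult_tmap) simp_all
    have "?d \<cdot> ((?f \<otimes> e C) \<otimes> (?h \<cdot> g)) = ?d \<cdot> (((?f \<otimes> e C) \<otimes> ?h) \<cdot> (\<one> (bang A) \<otimes> g))"
      by (subst tmap_comp) simp_all
    also have "\<dots> = \<one> (bang A) \<otimes> g"
      using t tcomult_type[of "tcomult (\<Delta> A) (\<Delta> B)" "\<Delta> C"]
      by (subst comp_ident_reassoc[OF 1]) simp_all
    finally show ?thesis .
  qed
  ultimately show ?thesis by simp
qed

definition "tensor_map A B = tensor_coalg A B \<cdot> bmap (\<epsilon> A \<otimes> \<epsilon> B)"

definition "unit_map = u \<K> \<cdot> \<delta> \<K> \<cdot> bmap (e \<K>)"

lemma monoidal_type [simp]:
  "Dom X (tensor_map A B) = bang A \<boxtimes> bang B" "Cod X (tensor_map A B) = bang (A \<boxtimes> B)"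
  "Dom X unit_map = \<K>" "Cod X unit_map = bang \<K>"
  by (simp_all add: tensor_map_def unit_map_def)

lemma coalg_map_tensor_map: "coalg_map (tensor_coalg A B) (tensor_map A B) (\<delta> (A \<boxtimes> B))"
  unfolding tensor_map_def by (intro coalg_map_lift coalg_tensor) simp_all

lemma tensor_map_eps: "tensor_map A B \<cdot> \<epsilon> (A \<boxtimes> B) = \<epsilon> A \<otimes> \<epsilon> B"
  unfolding tensor_map_def by (intro lift_eps coalg_tensor) simp_all

lemma tensor_coalg_eq: "(\<delta> A \<otimes> \<delta> B) \<cdot> tensor_map (bang A) (bang B) = tensor_coalg A B"
proof (rule coalg_map_eqI[of "tensor_coalg A B"])
  show "coalg_map (tensor_coalg A B) ((\<delta> A \<otimes> \<delta> B) \<cdot> tensor_map (bang A) (bang B)) (\<delta> (bang A \<boxtimes> bang B))"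
    by (intro coalg_map_comp[OF coalg_map_tmap coalg_map_tensor_map] coalg_map_delta)
  show "coalg_map (tensor_coalg A B) (tensor_coalg A B) (\<delta> (bang A \<boxtimes> bang B))"
    by (intro coalg_map_self coalg_tensor) simp
  show "(\<delta> A \<otimes> \<delta> B) \<cdot> tensor_map (bang A) (bang B) \<cdot> \<epsilon> (bang A \<boxtimes> bang B) =
      tensor_coalg A B \<cdot> \<epsilon> (bang A \<boxtimes> bang B)"
    using coalg_tensor[of A B] by (simp add: tensor_map_eps tmap_comp coalg_def)
qed

lemma coalg_map_tmap_bmap:
  assumes "Dom X f = A" "Cod X f = B" "Dom X g = C" "Cod X g = D"
  shows "coalg_map (tensor_coalg A C) (bmap f \<otimes> bmap g) (tensor_coalg B D)"
  using assms by (intro coalg_map_tmap coalg_map_bmap)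

lemma tensor_map_natural:
  assumes "Dom X f = A" "Cod X f = B" "Dom X g = C" "Cod X g = D"
  shows "(bmap f \<otimes> bmap g) \<cdot> tensor_map B D = tensor_map A C \<cdot> bmap (f \<otimes> g)"
proof (rule coalg_map_eqI)
  show "coalg_map (tensor_coalg A C) ((bmap f \<otimes> bmap g) \<cdot> tensor_map B D) (\<delta> (B \<boxtimes> D))"
    using assms by (intro coalg_map_comp[OF coalg_map_tmap_bmap coalg_map_tensor_map])
  show "coalg_map (tensor_coalg A C) (tensor_map A C \<cdot> bmap (f \<otimes> g)) (\<delta> (B \<boxtimes> D))"
    using assms by (intro coalg_map_comp[OF coalg_map_tensor_map coalg_map_bmap]) simp_all
  show "(bmap f \<otimes> bmap g) \<cdot> tensor_map B D \<cdot> \<epsilon> (B \<boxtimes> D) = tensor_map A C \<cdot> bmap (f \<otimes> g) \<cdot> \<epsilon> (B \<boxtimes> D)"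
    using assms by (simp add: tensor_map_eps bmap_eps tmap_comp
        comp_reassoc[OF tensor_map_eps])
qed

lemma tensor_map_assoc:
  "(tensor_map A B \<otimes> \<one> (bang C)) \<cdot> tensor_map (A \<boxtimes> B) C
    = (\<one> (bang A) \<otimes> tensor_map B C) \<cdot> tensor_map A (B \<boxtimes> C)"
proof (rule coalg_map_eqI)
  have "coalg_map (triple_coalg A B C) ((tensor_map A B \<otimes> \<one> (bang C)) \<cdot> tensor_map (A \<boxtimes> B) C)
      (\<delta> ((A \<boxtimes> B) \<boxtimes> C))"
    by (intro coalg_map_comp[OF coalg_map_triple_tmap coalg_map_tensor_map] coalg_map_tensor_map
        coalg_map_ident coalg_delta) simp
  then show "coalg_map (triple_coalg A B C) ((tensor_map A B \<otimes> \<one> (bang C)) \<cdot> tensor_map (A \<boxtimes> B) C)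
      (\<delta> (A \<boxtimes> (B \<boxtimes> C)))" by simp
  show "coalg_map (triple_coalg A B C) ((\<one> (bang A) \<otimes> tensor_map B C) \<cdot> tensor_map A (B \<boxtimes> C))
      (\<delta> (A \<boxtimes> (B \<boxtimes> C)))"
    by (intro coalg_map_comp[OF coalg_map_triple_right coalg_map_tensor_map] coalg_map_tensor_map)
  have "(tensor_map A B \<otimes> \<one> (bang C)) \<cdot> tensor_map (A \<boxtimes> B) C \<cdot> \<epsilon> ((A \<boxtimes> B) \<boxtimes> C)
      = (tensor_map A B \<otimes> \<one> (bang C)) \<cdot> (\<epsilon> (A \<boxtimes> B) \<otimes> \<epsilon> C)"
    by (simp add: tensor_map_eps del: tobj_assoc)
  also have "\<dots> = \<epsilon> A \<otimes> (\<epsilon> B \<otimes> \<epsilon> C)" by (simp add: tmap_comp tensor_map_eps tmap_assoc)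
  also have "\<dots> = (\<one> (bang A) \<otimes> tensor_map B C) \<cdot> tensor_map A (B \<boxtimes> C) \<cdot> \<epsilon> (A \<boxtimes> (B \<boxtimes> C))"
    by (simp add: tmap_comp tensor_map_eps)
  finally show "(tensor_map A B \<otimes> \<one> (bang C)) \<cdot> tensor_map (A \<boxtimes> B) C \<cdot> \<epsilon> (A \<boxtimes> (B \<boxtimes> C))
      = (\<one> (bang A) \<otimes> tensor_map B C) \<cdot> tensor_map A (B \<boxtimes> C) \<cdot> \<epsilon> (A \<boxtimes> (B \<boxtimes> C))"
    by simp
qed

lemma tensor_map_symm:
  "\<sigma> (bang A) (bang B) \<cdot> tensor_map B A = tensor_map A B \<cdot> bmap (\<sigma> A B)"
proof (rule coalg_map_eqI)
  have "coalg_map (tensor_coalg A B) (\<sigma> (bang A) (bang B)) (tensor_coalg B A)"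
    using coalg_map_pair[OF comon_coalg_tensor coalg_map_proj1 coalg_map_proj0, of A B]
      tcomult_symm[OF counital_bang[of A] counital_bang[of B]] by simp
  then show "coalg_map (tensor_coalg A B) (\<sigma> (bang A) (bang B) \<cdot> tensor_map B A) (\<delta> (B \<boxtimes> A))"
    using coalg_map_tensor_map by (rule coalg_map_comp)
  show "coalg_map (tensor_coalg A B) (tensor_map A B \<cdot> bmap (\<sigma> A B)) (\<delta> (B \<boxtimes> A))"
    by (intro coalg_map_comp[OF coalg_map_tensor_map coalg_map_bmap]) simp_all
  show "\<sigma> (bang A) (bang B) \<cdot> tensor_map B A \<cdot> \<epsilon> (B \<boxtimes> A) = tensor_map A B \<cdot> bmap (\<sigma> A B) \<cdot> \<epsilon> (B \<boxtimes> A)"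
    by (simp add: tensor_map_eps bmap_eps comp_reassoc[OF tensor_map_eps] symm_nat)
qed

lemma coalg_unit_map: "coalg unit_map"
  and coalg_map_e: "coalg_map (\<delta> A) (e A) unit_map"
proof -
  have q: "coalg_map (\<delta> \<K>) (e \<K> \<cdot> u \<K>) (\<delta> \<K>)"
    unfolding bmap_mzero[symmetric] by (intro coalg_map_bmap) simp_all
  note r = coalg_retract[OF coalg_delta q _ _ _ _ u_e]
  show "coalg unit_map" using r(1) by (simp add: unit_map_def)
  have "coalg_map (\<delta> A) (bmap (\<zero> A \<K>) \<cdot> e \<K>) unit_map"
    using r(3) by (intro coalg_map_comp[OF coalg_map_bmap]) (simp_all add: unit_map_def)
  then show "coalg_map (\<delta> A) (e A) unit_map" by simp
qed

lemma coalg_map_unit_map: "coalg_map unit_map unit_map (\<delta> \<K>)"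
  by (intro coalg_map_self coalg_unit_map) simp

lemma unit_map_eps: "unit_map \<cdot> \<epsilon> \<K> = \<one> \<K>"
  using coalg_unit_map by (simp add: coalg_def)

lemma tensor_map_unit:
  "(unit_map \<otimes> \<one> (bang A)) \<cdot> tensor_map \<K> A = \<one> (bang A)"
  "(\<one> (bang A) \<otimes> unit_map) \<cdot> tensor_map A \<K> = \<one> (bang A)"
proof -
  have e: "coalg_map (\<delta> A) (e A \<cdot> unit_map) (\<delta> \<K>)"
    by (intro coalg_map_comp[OF coalg_map_e coalg_map_unit_map])
  have i: "coalg_map (\<delta> A) (\<one> (bang A)) (\<delta> A)" by (intro coalg_map_ident coalg_delta) simp
  have "coalg_map (\<delta> A) (\<Delta> A \<cdot> ((e A \<cdot> unit_map) \<otimes> \<one> (bang A))) (tensor_coalg \<K> A)"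
    by (intro coalg_map_pair[OF comon_coalg_delta e i])
  moreover have "\<Delta> A \<cdot> ((e A \<cdot> unit_map) \<otimes> \<one> (bang A)) = unit_map \<otimes> \<one> (bang A)"
  proof -
    have "\<Delta> A \<cdot> ((e A \<cdot> unit_map) \<otimes> \<one> (bang A)) = \<Delta> A \<cdot> ((e A \<otimes> \<one> (bang A)) \<cdot> (unit_map \<otimes> \<one> (bang A)))"
      by (subst tmap_comp) simp_all
    then show ?thesis by (simp add: comp_ident_reassoc[OF Delta_counit_left])
  qed
  ultimately have l: "coalg_map (\<delta> A) (unit_map \<otimes> \<one> (bang A)) (tensor_coalg \<K> A)" by simp
  have "coalg_map (\<delta> A) (\<Delta> A \<cdot> (\<one> (bang A) \<otimes> (e A \<cdot> unit_map))) (tensor_coalg A \<K>)"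
    by (intro coalg_map_pair[OF comon_coalg_delta i e])
  moreover have "\<Delta> A \<cdot> (\<one> (bang A) \<otimes> (e A \<cdot> unit_map)) = \<one> (bang A) \<otimes> unit_map"
  proof -
    have "\<Delta> A \<cdot> (\<one> (bang A) \<otimes> (e A \<cdot> unit_map)) = \<Delta> A \<cdot> ((\<one> (bang A) \<otimes> e A) \<cdot> (\<one> (bang A) \<otimes> unit_map))"
      by (subst tmap_comp) simp_all
    then show ?thesis by (simp add: comp_ident_reassoc[OF Delta_counit_right])
  qed
  ultimately have r: "coalg_map (\<delta> A) (\<one> (bang A) \<otimes> unit_map) (tensor_coalg A \<K>)" by simp
  show "(unit_map \<otimes> \<one> (bang A)) \<cdot> tensor_map \<K> A = \<one> (bang A)"
    by (rule coalg_map_eqI[OF coalg_map_comp[OF l coalg_map_tensor_map, simplified] i])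
      (use tensor_map_eps[of \<K> A] in \<open>simp add: tmap_comp unit_map_eps\<close>)
  show "(\<one> (bang A) \<otimes> unit_map) \<cdot> tensor_map A \<K> = \<one> (bang A)"
    by (rule coalg_map_eqI[OF coalg_map_comp[OF r coalg_map_tensor_map, simplified] i])
      (use tensor_map_eps[of A \<K>] in \<open>simp add: tmap_comp unit_map_eps\<close>)
qed

lemma comon_map_tensor_map:
  "comon_map (tcomult (\<Delta> A) (\<Delta> B)) (e A \<otimes> e B) (tensor_map A B) (\<Delta> (A \<boxtimes> B)) (e (A \<boxtimes> B))"
  using comon_coalg_tensor[of A B] unfolding tensor_map_def
  by (intro comon_map_comp[OF _ comon_map_bmap]) (simp_all add: comon_coalg_def)

lemma comon_map_unit_map: "comon_map (\<one> \<K>) (\<one> \<K>) unit_map (\<Delta> \<K>) (e \<K>)"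
  unfolding unit_map_def
  by (intro comon_map_comp[OF comon_map_comp[OF comon_map_u comon_map_delta] comon_map_bmap]) simp_all

lemma coalg_map_Delta: "coalg_map (\<delta> A) (\<Delta> A) (tensor_coalg A A)"
proof -
  have i: "coalg_map (\<delta> A) (\<one> (bang A)) (\<delta> A)" by (intro coalg_map_ident coalg_delta) simp
  show ?thesis using coalg_map_pair[OF comon_coalg_delta i i] by simp
qed

theorem monoidal_coalgebra_modality_of_bialgebra:
  "monoidal_coalgebra_modality X bang bmap \<delta> \<epsilon> \<Delta> e tensor_map unit_map"
proof
  fix A B C D f g
  show "tensor_map A B \<in> homset X (bang A \<boxtimes> bang B) (bang (A \<boxtimes> B))" by simp
  show "unit_map \<in> homset X \<K> (bang \<K>)" by simp
  show "(tensor_map A B \<otimes> \<one> (bang C)) \<cdot> tensor_map (A \<boxtimes> B) C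
    = (\<one> (bang A) \<otimes> tensor_map B C) \<cdot> tensor_map A (B \<boxtimes> C)" by (rule tensor_map_assoc)
  show "(unit_map \<otimes> \<one> (bang A)) \<cdot> tensor_map \<K> A = \<one> (bang A)"
    "(\<one> (bang A) \<otimes> unit_map) \<cdot> tensor_map A \<K> = \<one> (bang A)" by (rule tensor_map_unit)+
  show "\<sigma> (bang A) (bang B) \<cdot> tensor_map B A = tensor_map A B \<cdot> bmap (\<sigma> A B)" by (rule tensor_map_symm)
  show "tensor_map A B \<cdot> \<delta> (A \<boxtimes> B) =
      (\<delta> A \<otimes> \<delta> B) \<cdot> tensor_map (bang A) (bang B) \<cdot> bmap (tensor_map A B)"
    using coalg_map_tensor_map[of A B] by (simp only: tensor_coalg_eq coalg_map_def)
  show "unit_map \<cdot> \<delta> \<K> = unit_map \<cdot> bmap unit_map"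
    using coalg_unit_map by (simp add: coalg_def)
  show "tensor_map A B \<cdot> \<epsilon> (A \<boxtimes> B) = \<epsilon> A \<otimes> \<epsilon> B" by (rule tensor_map_eps)
  show "unit_map \<cdot> \<epsilon> \<K> = \<one> \<K>" by (rule unit_map_eps)
  show "tensor_map A B \<cdot> \<Delta> (A \<boxtimes> B) =
      (\<Delta> A \<otimes> \<Delta> B) \<cdot> (\<one> (bang A) \<otimes> \<sigma> (bang A) (bang B) \<otimes> \<one> (bang B)) \<cdot> (tensor_map A B \<otimes> tensor_map A B)"
    "tensor_map A B \<cdot> e (A \<boxtimes> B) = e A \<otimes> e B"
    using comon_map_tensor_map[of A B]
    by (simp_all only: comon_map_def tcomult_def coalgebra_modality_type)
  show "unit_map \<cdot> \<Delta> \<K> = unit_map \<otimes> unit_map" "unit_map \<cdot> e \<K> = \<one> \<K>"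
    using comon_map_unit_map by (simp_all add: comon_map_def)
  show "\<delta> A \<cdot> bmap (\<Delta> A) = \<Delta> A \<cdot> (\<delta> A \<otimes> \<delta> A) \<cdot> tensor_map (bang A) (bang A)"
    using coalg_map_Delta[of A] by (simp add: tensor_coalg_eq coalg_map_def)
  show "\<delta> A \<cdot> bmap (e A) = e A \<cdot> unit_map"
    using coalg_map_e[of A] by (simp add: coalg_map_def)
qed (simp add: tensor_map_natural)

lemma nabla_of_tensor_map:
  "(\<delta> A \<otimes> \<delta> A) \<cdot> tensor_map (bang A) (bang A) \<cdot> bmap ((\<epsilon> A \<otimes> e A) \<oplus> (e A \<otimes> \<epsilon> A)) = nabla A"
  unfolding tensor_coalg_eq
proof (rule coalg_map_eqI)
  show "coalg_map (tensor_coalg A A) (tensor_coalg A A \<cdot> bmap ((\<epsilon> A \<otimes> e A) \<oplus> (e A \<otimes> \<epsilon> A))) (\<delta> A)"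
    by (intro coalg_map_lift coalg_tensor) simp_all
  have "tcomult (\<Delta> A) (\<Delta> A) \<cdot> ((\<one> (bang A) \<otimes> e A) \<otimes> (e A \<otimes> \<one> (bang A))) = \<one> (bang A \<boxtimes> bang A)"
    using tcomult_projections[OF counital_bang[of A] counital_bang[of A]] by simp
  then show "coalg_map (tensor_coalg A A) (nabla A) (\<delta> A)"
    using coalg_map_conv[OF comon_coalg_tensor coalg_map_proj0 coalg_map_proj1, of A] by simp
  show "tensor_coalg A A \<cdot> bmap ((\<epsilon> A \<otimes> e A) \<oplus> (e A \<otimes> \<epsilon> A)) \<cdot> \<epsilon> A = nabla A \<cdot> \<epsilon> A"
    unfolding nabla_eps by (intro lift_eps coalg_tensor) simp_all
qed

lemma u_of_unit_map: "unit_map \<cdot> bmap (\<zero> \<K> A) = u A"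
proof -
  have "unit_map \<cdot> bmap (\<zero> \<K> A) = u \<K> \<cdot> (\<delta> \<K> \<cdot> bmap (e \<K> \<cdot> \<zero> \<K> A))"
    by (simp add: unit_map_def bmap_comp del: comp_mzero)
  also have "\<dots> = u \<K> \<cdot> (e \<K> \<cdot> u A)" by (simp add: delta_bmap_zero)
  also have "\<dots> = u A" by (simp add: comp_ident_reassoc[OF u_e])
  finally show ?thesis .
qed

lemma tensor_map_expand:
  "(\<delta> A \<otimes> \<delta> B) \<cdot> (bmap (\<one> (bang A) \<otimes> u B) \<otimes> bmap (u A \<otimes> \<one> (bang B)))
    \<cdot> nabla (bang A \<boxtimes> bang B) \<cdot> \<delta> (bang A \<boxtimes> bang B) \<cdot> bmap (\<Delta> (bang A \<boxtimes> bang B))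
    \<cdot> bmap (bmap (\<epsilon> A \<otimes> e B) \<otimes> bmap (e A \<otimes> \<epsilon> B)) \<cdot> bmap (\<epsilon> A \<otimes> \<epsilon> B) = tensor_map A B"
  by (simp add: tensor_map_def tensor_coalg_def merge_def inj0_def inj1_def split_def
      bmap_comp tmap_comp tmap_comp_reassoc)

end

section \<open>From monoidal coalgebra modalities to additive bialgebra modalities\<close>

locale additive_linear = additive_smc X + monoidal_coalgebra_modality X bang bmap \<delta> \<epsilon> \<Delta> e m mK
  for X :: "('o, 'a, 'z) additive_smc_data_scheme"  (structure)
    and bang bmap \<delta> \<epsilon> \<Delta> e m mK
begin

lemma monoidal_modality_type [simp]:
  "Dom X (m A B) = bang A \<boxtimes> bang B" "Cod X (m A B) = bang (A \<boxtimes> B)"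
  "Dom X mK = \<K>" "Cod X mK = bang \<K>"
  using m_hom[of A B] mK_hom by simp_all

lemma m_bmap:
  "Cod X f = B \<Longrightarrow> Cod X g = D \<Longrightarrow> (bmap f \<otimes> bmap g) \<cdot> m B D = m (Dom X f) (Dom X g) \<cdot> bmap (f \<otimes> g)"
  using m_natural[of f "Dom X f" B g "Dom X g" D] by simp

definition "tens c d = (c \<otimes> d) \<cdot> m (Dom X c) (Dom X d)"

lemma coalg_tens:
  assumes "coalg c" "coalg d"
  shows "coalg (tens c d)"
proof -
  note a = assms[unfolded coalg_def]
  let ?C = "Dom X c" and ?D = "Dom X d"
  have "(c \<otimes> d) \<cdot> (m ?C ?D \<cdot> \<delta> (?C \<boxtimes> ?D))
      = (c \<otimes> d) \<cdot> ((\<delta> ?C \<otimes> \<delta> ?D) \<cdot> (m (bang ?C) (bang ?D) \<cdot> bmap (m ?C ?D)))"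
    by (simp add: m_delta)
  also have "\<dots> = ((c \<cdot> bmap c) \<otimes> (d \<cdot> bmap d)) \<cdot> (m (bang ?C) (bang ?D) \<cdot> bmap (m ?C ?D))"
    using a by (simp add: tmap_comp_reassoc)
  also have "\<dots> = (c \<otimes> d) \<cdot> ((bmap c \<otimes> bmap d) \<cdot> m (bang ?C) (bang ?D) \<cdot> bmap (m ?C ?D))"
    using a by (simp add: tmap_comp_reassoc)
  also have "\<dots> = (c \<otimes> d) \<cdot> (m ?C ?D \<cdot> bmap ((c \<otimes> d) \<cdot> m ?C ?D))"
    using a by (simp add: m_bmap bmap_comp)
  finally show ?thesis using a by (simp add: coalg_def tens_def m_eps tmap_comp)
qed

lemma coalg_map_tens:
  assumes "coalg_map c f c'" "coalg_map d g d'"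
  shows "coalg_map (tens c d) (f \<otimes> g) (tens c' d')"
proof -
  note a = assms[unfolded coalg_map_def coalg_def]
  have "(f \<otimes> g) \<cdot> tens c' d' = ((c \<cdot> bmap f) \<otimes> (d \<cdot> bmap g)) \<cdot> m (Dom X c') (Dom X d')"
    using a by (simp add: tens_def tmap_comp_reassoc)
  also have "\<dots> = (c \<otimes> d) \<cdot> ((bmap f \<otimes> bmap g) \<cdot> m (Dom X c') (Dom X d'))"
    using a by (simp add: tmap_comp_reassoc)
  also have "\<dots> = tens c d \<cdot> bmap (f \<otimes> g)"
    using a by (simp add: m_bmap tens_def)
  finally show ?thesis using a coalg_tens assms
    by (simp add: coalg_map_def) (simp add: tens_def)
qed

lemma tens_type: "coalg c \<Longrightarrow> coalg d \<Longrightarrow> Dom X (tens c d) = Dom X c \<boxtimes> Dom X d"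
  by (simp add: coalg_def tens_def)

lemma tens_assoc:
  assumes "coalg c" "coalg d" "coalg b"
  shows "tens (tens c d) b = tens c (tens d b)"
proof -
  note a = assms[unfolded coalg_def]
  let ?C = "Dom X c" and ?D = "Dom X d" and ?B = "Dom X b"
  have "tens (tens c d) b = (((c \<otimes> d) \<cdot> m ?C ?D) \<otimes> (b \<cdot> \<one> (bang ?B))) \<cdot> m (?C \<boxtimes> ?D) ?B"
    using a by (simp add: tens_def)
  also have "\<dots> = ((c \<otimes> d) \<otimes> b) \<cdot> ((m ?C ?D \<otimes> \<one> (bang ?B)) \<cdot> m (?C \<boxtimes> ?D) ?B)"
    using a by (simp add: tmap_comp_reassoc)
  also have "\<dots> = (c \<otimes> (d \<otimes> b)) \<cdot> ((\<one> (bang ?C) \<otimes> m ?D ?B) \<cdot> m ?C (?D \<boxtimes> ?B))"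
    by (simp only: m_assoc tmap_assoc)
  also have "\<dots> = ((c \<cdot> \<one> (bang ?C)) \<otimes> ((d \<otimes> b) \<cdot> m ?D ?B)) \<cdot> m ?C (?D \<boxtimes> ?B)"
    using a by (intro tmap_comp_reassoc) simp_all
  also have "\<dots> = tens c (tens d b)"
    using a by (simp add: tens_def)
  finally show ?thesis .
qed

lemma coalg_mK: "coalg mK"
  by (simp add: coalg_def mK_eps mK_delta)

lemma tens_mK: "coalg c \<Longrightarrow> tens mK c = c" "coalg c \<Longrightarrow> tens c mK = c"
proof -
  assume c: "coalg c"
  note a = c[unfolded coalg_def]
  have "tens mK c = (\<one> \<K> \<otimes> c) \<cdot> ((mK \<otimes> \<one> (bang (Dom X c))) \<cdot> m \<K> (Dom X c))"
    using a by (subst tmap_comp_reassoc) (simp_all add: tens_def)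
  then show "tens mK c = c" using a by (simp add: m_unit_left)
  have "tens c mK = (c \<otimes> \<one> \<K>) \<cdot> ((\<one> (bang (Dom X c)) \<otimes> mK) \<cdot> m (Dom X c) \<K>)"
    using a by (subst tmap_comp_reassoc) (simp_all add: tens_def)
  then show "tens c mK = c" using a by (simp add: m_unit_right)
qed

lemma coalg_map_symm: "coalg_map (tens (\<delta> A) (\<delta> B)) (\<sigma> (bang A) (bang B)) (tens (\<delta> B) (\<delta> A))"
proof -
  have "\<sigma> (bang A) (bang B) \<cdot> tens (\<delta> B) (\<delta> A)
      = (\<sigma> (bang A) (bang B) \<cdot> (\<delta> B \<otimes> \<delta> A)) \<cdot> m (bang B) (bang A)"
    by (simp add: tens_def)
  also have "\<dots> = ((\<delta> A \<otimes> \<delta> B) \<cdot> \<sigma> (bang (bang A)) (bang (bang B))) \<cdot> m (bang B) (bang A)"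
    by (simp only: symm_nat coalgebra_modality_type)
  also have "\<dots> = (\<delta> A \<otimes> \<delta> B) \<cdot> (\<sigma> (bang (bang A)) (bang (bang B)) \<cdot> m (bang B) (bang A))"
    by simp
  also have "\<dots> = tens (\<delta> A) (\<delta> B) \<cdot> bmap (\<sigma> (bang A) (bang B))"
    by (simp add: m_symm tens_def)
  finally show ?thesis
    by (simp add: coalg_map_def coalg_tens coalg_delta tens_type)
qed

lemma comon_map_m:
  "comon_map (tcomult (\<Delta> A) (\<Delta> B)) (e A \<otimes> e B) (m A B) (\<Delta> (A \<boxtimes> B)) (e (A \<boxtimes> B))"
  using m_Delta[of A B] m_e[of A B]
  by (simp add: comon_map_def comon_type_bang comon_type_tcomult tcomult_type)
    (simp add: tcomult_def)

lemma comon_map_tens: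
  "comon_map (tcomult (\<Delta> A) (\<Delta> B)) (e A \<otimes> e B) (tens (\<delta> A) (\<delta> B))
    (\<Delta> (bang A \<boxtimes> bang B)) (e (bang A \<boxtimes> bang B))"
  unfolding tens_def coalgebra_modality_type
  by (intro comon_map_comp[OF comon_map_tmap comon_map_m] comon_map_delta)

definition "mult A = tens (\<delta> A) (\<delta> A) \<cdot> bmap ((\<epsilon> A \<otimes> e A) \<oplus> (e A \<otimes> \<epsilon> A))"

definition "unit A = mK \<cdot> bmap (\<zero> \<K> A)"

lemma mult_type [simp]:
  "Dom X (mult A) = bang A \<boxtimes> bang A" "Cod X (mult A) = bang A"
  "Dom X (unit A) = \<K>" "Cod X (unit A) = bang A"
  by (simp_all add: mult_def unit_def tens_def)

lemma coalg_map_mult: "coalg_map (tens (\<delta> A) (\<delta> A)) (mult A) (\<delta> A)"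
  unfolding mult_def by (intro coalg_map_lift coalg_tens coalg_delta) (simp_all add: tens_type coalg_delta)

lemma coalg_map_unit: "coalg_map mK (unit A) (\<delta> A)"
  unfolding unit_def by (intro coalg_map_lift coalg_mK) simp_all

lemma mult_eps: "mult A \<cdot> \<epsilon> A = (\<epsilon> A \<otimes> e A) \<oplus> (e A \<otimes> \<epsilon> A)"
  unfolding mult_def by (intro lift_eps coalg_tens coalg_delta) (simp_all add: tens_type coalg_delta)

lemma unit_eps: "unit A \<cdot> \<epsilon> A = \<zero> \<K> A"
  unfolding unit_def by (intro lift_eps coalg_mK) simp_all

lemma comon_map_mult: "comon_map (tcomult (\<Delta> A) (\<Delta> A)) (e A \<otimes> e A) (mult A) (\<Delta> A) (e A)"
  unfolding mult_def by (intro comon_map_comp[OF comon_map_tens comon_map_bmap]) simp_all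

lemma mult_e: "mult A \<cdot> e A = e A \<otimes> e A"
  using comon_map_mult[of A] unfolding comon_map_def by metis

lemma comon_map_unit: "comon_map (\<one> \<K>) (\<one> \<K>) (unit A) (\<Delta> A) (e A)"
proof -
  have "comon_map (\<one> \<K>) (\<one> \<K>) mK (\<Delta> \<K>) (e \<K>)"
    by (simp add: comon_map_def comon_type_def mK_Delta mK_e)
  then show ?thesis unfolding unit_def by (rule comon_map_comp[OF _ comon_map_bmap]) simp_all
qed

lemma unit_e: "unit A \<cdot> e A = \<one> \<K>"
  using comon_map_unit[of A] unfolding comon_map_def by metis

lemma coalg_map_e_mK: "coalg_map (\<delta> A) (e A) mK"
  by (simp add: coalg_map_def coalg_delta coalg_mK e_coalgebra)

lemma coalg_map_Delta_tens: "coalg_map (\<delta> A) (\<Delta> A) (tens (\<delta> A) (\<delta> A))"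
  by (simp add: coalg_map_def coalg_delta coalg_tens tens_type) (simp add: tens_def Delta_coalgebra)

lemma coalg_map_ident_delta: "coalg_map (\<delta> A) (\<one> (bang A)) (\<delta> A)"
  by (intro coalg_map_ident coalg_delta) simp

lemma tmap_mult_eps:
  assumes "Cod X f = bang A" "Cod X g = bang A"
  shows "(f \<otimes> g) \<cdot> (mult A \<cdot> \<epsilon> A) = ((f \<cdot> \<epsilon> A) \<otimes> (g \<cdot> e A)) \<oplus> ((f \<cdot> e A) \<otimes> (g \<cdot> \<epsilon> A))"
  using assms by (simp add: mult_eps comp_madd tmap_comp)

lemma mult_natural:
  assumes "Dom X f = A" "Cod X f = B"
  shows "(bmap f \<otimes> bmap f) \<cdot> mult B = mult A \<cdot> bmap f"
proof (rule coalg_map_eqI)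
  show "coalg_map (tens (\<delta> A) (\<delta> A)) ((bmap f \<otimes> bmap f) \<cdot> mult B) (\<delta> B)"
    using assms by (intro coalg_map_comp[OF coalg_map_tens coalg_map_mult] coalg_map_bmap)
  show "coalg_map (tens (\<delta> A) (\<delta> A)) (mult A \<cdot> bmap f) (\<delta> B)"
    using assms by (intro coalg_map_comp[OF coalg_map_mult coalg_map_bmap])
  have "mult A \<cdot> (\<epsilon> A \<cdot> f) = ((\<epsilon> A \<otimes> e A) \<oplus> (e A \<otimes> \<epsilon> A)) \<cdot> f"
    using assms by (intro comp_reassoc mult_eps) simp_all
  also have "\<dots> = ((\<epsilon> A \<otimes> e A) \<cdot> (f \<otimes> \<one> \<K>)) \<oplus> ((e A \<otimes> \<epsilon> A) \<cdot> (\<one> \<K> \<otimes> f))"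
    using assms by (simp add: madd_comp)
  also have "\<dots> = ((\<epsilon> A \<cdot> f) \<otimes> e A) \<oplus> (e A \<otimes> (\<epsilon> A \<cdot> f))"
    using assms by (simp add: tmap_comp del: unit_tmap tmap_unit)
  finally show "(bmap f \<otimes> bmap f) \<cdot> mult B \<cdot> \<epsilon> B = mult A \<cdot> bmap f \<cdot> \<epsilon> B"
    using assms by (simp add: tmap_mult_eps bmap_eps)
qed

lemma mult_assoc: "(mult A \<otimes> \<one> (bang A)) \<cdot> mult A = (\<one> (bang A) \<otimes> mult A) \<cdot> mult A"
proof (rule coalg_map_eqI)
  let ?t = "tens (tens (\<delta> A) (\<delta> A)) (\<delta> A)"
  show "coalg_map ?t ((mult A \<otimes> \<one> (bang A)) \<cdot> mult A) (\<delta> A)"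
    by (intro coalg_map_comp[OF coalg_map_tens coalg_map_mult] coalg_map_mult coalg_map_ident_delta)
  show "coalg_map ?t ((\<one> (bang A) \<otimes> mult A) \<cdot> mult A) (\<delta> A)"
    unfolding tens_assoc[OF coalg_delta coalg_delta coalg_delta]
    by (intro coalg_map_comp[OF coalg_map_tens coalg_map_mult] coalg_map_mult coalg_map_ident_delta)
  have "(mult A \<otimes> \<one> (bang A)) \<cdot> (mult A \<cdot> \<epsilon> A) = (\<one> (bang A) \<otimes> mult A) \<cdot> (mult A \<cdot> \<epsilon> A)"
    by (simp add: tmap_mult_eps mult_e)
      (simp add: mult_eps tmap_distrib_right tmap_distrib_left tmap_assoc
        madd_assoc[of _ "bang A \<boxtimes> (bang A \<boxtimes> bang A)" A])
  then show "(mult A \<otimes> \<one> (bang A)) \<cdot> mult A \<cdot> \<epsilon> A = (\<one> (bang A) \<otimes> mult A) \<cdot> mult A \<cdot> \<epsilon> A"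
    by simp
qed

lemma mult_unit:
  "(unit A \<otimes> \<one> (bang A)) \<cdot> mult A = \<one> (bang A)" "(\<one> (bang A) \<otimes> unit A) \<cdot> mult A = \<one> (bang A)"
proof -
  have l: "coalg_map (\<delta> A) ((unit A \<otimes> \<one> (bang A)) \<cdot> mult A) (\<delta> A)"
    using coalg_map_comp[OF coalg_map_tens[OF coalg_map_unit coalg_map_ident_delta] coalg_map_mult, of A]
    by (simp add: tens_mK coalg_delta)
  have r: "coalg_map (\<delta> A) ((\<one> (bang A) \<otimes> unit A) \<cdot> mult A) (\<delta> A)"
    using coalg_map_comp[OF coalg_map_tens[OF coalg_map_ident_delta coalg_map_unit] coalg_map_mult, of A]
    by (simp add: tens_mK coalg_delta)
  show "(unit A \<otimes> \<one> (bang A)) \<cdot> mult A = \<one> (bang A)"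
    by (rule coalg_map_eqI[OF l coalg_map_ident_delta]) (simp add: tmap_mult_eps unit_eps unit_e)
  show "(\<one> (bang A) \<otimes> unit A) \<cdot> mult A = \<one> (bang A)"
    by (rule coalg_map_eqI[OF r coalg_map_ident_delta]) (simp add: tmap_mult_eps unit_eps unit_e)
qed

lemma mult_comm: "\<sigma> (bang A) (bang A) \<cdot> mult A = mult A"
proof (rule coalg_map_eqI[OF coalg_map_comp[OF coalg_map_symm coalg_map_mult] coalg_map_mult])
  have "\<sigma> (bang A) (bang A) \<cdot> (mult A \<cdot> \<epsilon> A) = (e A \<otimes> \<epsilon> A) \<oplus> (\<epsilon> A \<otimes> e A)"
    using symm_nat[of "\<epsilon> A" A "e A" \<K>] symm_nat[of "e A" \<K> "\<epsilon> A" A]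
    by (simp add: mult_eps comp_madd)
  then show "\<sigma> (bang A) (bang A) \<cdot> mult A \<cdot> \<epsilon> A = mult A \<cdot> \<epsilon> A"
    using madd_commute[of "\<epsilon> A \<otimes> e A" "bang A \<boxtimes> bang A" A "e A \<otimes> \<epsilon> A"] by (simp add: mult_eps)
qed

lemma bmap_add:
  assumes "Dom X f = A" "Cod X f = B" "Dom X g = A" "Cod X g = B"
  shows "bmap (f \<oplus> g) = \<Delta> A \<cdot> (bmap f \<otimes> bmap g) \<cdot> mult B"
proof (rule coalg_map_eqI)
  show "coalg_map (\<delta> A) (bmap (f \<oplus> g)) (\<delta> B)"
    using assms by (intro coalg_map_bmap) simp_all
  show "coalg_map (\<delta> A) (\<Delta> A \<cdot> (bmap f \<otimes> bmap g) \<cdot> mult B) (\<delta> B)"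
    using assms by (intro coalg_map_comp[OF coalg_map_comp[OF coalg_map_Delta_tens coalg_map_tens] coalg_map_mult]
        coalg_map_bmap)
  have "\<Delta> A \<cdot> ((\<epsilon> A \<cdot> f) \<otimes> e A) = \<Delta> A \<cdot> ((\<one> (bang A) \<otimes> e A) \<cdot> ((\<epsilon> A \<cdot> f) \<otimes> \<one> \<K>))"
    using assms by (subst tmap_comp) simp_all
  then have 1: "\<Delta> A \<cdot> ((\<epsilon> A \<cdot> f) \<otimes> e A) = \<epsilon> A \<cdot> f"
    using assms by (simp add: comp_ident_reassoc[OF Delta_counit_right])
  have "\<Delta> A \<cdot> (e A \<otimes> (\<epsilon> A \<cdot> g)) = \<Delta> A \<cdot> ((e A \<otimes> \<one> (bang A)) \<cdot> (\<one> \<K> \<otimes> (\<epsilon> A \<cdot> g)))"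
    using assms by (subst tmap_comp) simp_all
  then have 2: "\<Delta> A \<cdot> (e A \<otimes> (\<epsilon> A \<cdot> g)) = \<epsilon> A \<cdot> g"
    using assms by (simp add: comp_ident_reassoc[OF Delta_counit_left])
  have "\<Delta> A \<cdot> (bmap f \<otimes> bmap g) \<cdot> mult B \<cdot> \<epsilon> B = \<Delta> A \<cdot> ((bmap f \<otimes> bmap g) \<cdot> (mult B \<cdot> \<epsilon> B))"
    using assms by simp
  also have "(bmap f \<otimes> bmap g) \<cdot> (mult B \<cdot> \<epsilon> B)
      = ((\<epsilon> A \<cdot> f) \<otimes> e A) \<oplus> (e A \<otimes> (\<epsilon> A \<cdot> g))"
    using assms by (subst tmap_mult_eps) (simp_all add: bmap_eps)
  also have "\<Delta> A \<cdot> \<dots> = (\<Delta> A \<cdot> ((\<epsilon> A \<cdot> f) \<otimes> e A)) \<oplus> (\<Delta> A \<cdot> (e A \<otimes> (\<epsilon> A \<cdot> g)))"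
    using assms by (intro comp_madd) simp_all
  also have "\<dots> = \<epsilon> A \<cdot> (f \<oplus> g)"
    unfolding 1 2 using assms by (subst comp_madd) simp_all
  also have "\<dots> = bmap (f \<oplus> g) \<cdot> \<epsilon> B"
    using assms by (subst bmap_eps) simp_all
  finally show "bmap (f \<oplus> g) \<cdot> \<epsilon> B = \<Delta> A \<cdot> (bmap f \<otimes> bmap g) \<cdot> mult B \<cdot> \<epsilon> B" ..
qed

lemma bmap_zero: "bmap (\<zero> A B) = e A \<cdot> unit B"
proof (rule coalg_map_eqI)
  show "coalg_map (\<delta> A) (bmap (\<zero> A B)) (\<delta> B)" by (intro coalg_map_bmap) simp_all
  show "coalg_map (\<delta> A) (e A \<cdot> unit B) (\<delta> B)"
    by (intro coalg_map_comp[OF coalg_map_e_mK coalg_map_unit])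
  show "bmap (\<zero> A B) \<cdot> \<epsilon> B = e A \<cdot> unit B \<cdot> \<epsilon> B" by (simp add: bmap_eps unit_eps)
qed

theorem additive_bialgebra_modality_of_monoidal:
  "additive_bialgebra_modality X bang bmap \<delta> \<epsilon> \<Delta> e mult unit"
proof
  fix A B f g
  show "mult A \<in> homset X (bang A \<boxtimes> bang A) (bang A)" "unit A \<in> homset X \<K> (bang A)" by simp_all
  show "(mult A \<otimes> \<one> (bang A)) \<cdot> mult A = (\<one> (bang A) \<otimes> mult A) \<cdot> mult A" by (rule mult_assoc)
  show "(unit A \<otimes> \<one> (bang A)) \<cdot> mult A = \<one> (bang A)" "(\<one> (bang A) \<otimes> unit A) \<cdot> mult A = \<one> (bang A)"
    by (rule mult_unit)+
  show "\<sigma> (bang A) (bang A) \<cdot> mult A = mult A" by (rule mult_comm)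
  show "mult A \<cdot> e A = e A \<otimes> e A" by (rule mult_e)
  show "unit A \<cdot> \<Delta> A = unit A \<otimes> unit A" using comon_map_unit[of A] by (simp add: comon_map_def)
  show "unit A \<cdot> e A = \<one> \<K>" by (rule unit_e)
  show "mult A \<cdot> \<Delta> A =
      (\<Delta> A \<otimes> \<Delta> A) \<cdot> (\<one> (bang A) \<otimes> \<sigma> (bang A) (bang A) \<otimes> \<one> (bang A)) \<cdot> (mult A \<otimes> mult A)"
    using comon_map_mult[of A] by (simp only: comon_map_def tcomult_def coalgebra_modality_type)
  show "mult A \<cdot> \<epsilon> A = (\<epsilon> A \<otimes> e A) \<oplus> (e A \<otimes> \<epsilon> A)" by (rule mult_eps)
  show "bmap (\<zero> A B) = e A \<cdot> unit B" by (rule bmap_zero)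
  show "unit A \<cdot> bmap f = unit B" if "f \<in> homset X A B"
    using that by (simp add: unit_def bmap_comp[symmetric])
  show "(bmap f \<otimes> bmap f) \<cdot> mult B = mult A \<cdot> bmap f" if "f \<in> homset X A B"
    using that by (intro mult_natural) simp_all
  show "bmap (f \<oplus> g) = \<Delta> A \<cdot> (bmap f \<otimes> bmap g) \<cdot> mult B"
    if "f \<in> homset X A B" "g \<in> homset X A B"
    using that by (intro bmap_add) simp_all
qed

sublocale B: additive_bialgebra_modality X bang bmap \<delta> \<epsilon> \<Delta> e mult unit
  by (rule additive_bialgebra_modality_of_monoidal)

lemma tensor_map_eq_m: "B.tensor_map A B = m A B"
proof (rule coalg_map_eqI)
  have "coalg_map (tens (\<delta> A) (\<delta> B)) (B.merge A B) (\<delta> (bang A \<boxtimes> bang B))"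
    unfolding B.merge_def
    by (intro coalg_map_comp[OF coalg_map_tens coalg_map_mult] B.coalg_map_inj0 B.coalg_map_inj1)
  then show "coalg_map (tens (\<delta> A) (\<delta> B)) (B.tensor_map A B) (\<delta> (A \<boxtimes> B))"
    unfolding B.tensor_map_def B.tensor_coalg_def
    by (intro coalg_map_comp[OF coalg_map_comp[OF coalg_map_comp[OF _ coalg_map_delta] coalg_map_bmap] coalg_map_bmap])
      simp_all
  show "coalg_map (tens (\<delta> A) (\<delta> B)) (m A B) (\<delta> (A \<boxtimes> B))"
    by (simp add: coalg_map_def coalg_delta coalg_tens tens_type m_delta) (simp add: tens_def)
  show "B.tensor_map A B \<cdot> \<epsilon> (A \<boxtimes> B) = m A B \<cdot> \<epsilon> (A \<boxtimes> B)"
    by (simp add: B.tensor_map_eps m_eps)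
qed

lemma unit_map_eq_mK: "B.unit_map = mK"
proof -
  have "B.unit_map = unit \<K> \<cdot> (e \<K> \<cdot> mK)" by (simp add: B.unit_map_def e_coalgebra)
  then show ?thesis by (simp add: comp_ident_reassoc[OF unit_e])
qed

end

section \<open>The bijection\<close>

lemma monoidal_of_bialgebra_eq:
  assumes "additive_bialgebra_modality X bang bmap \<delta> \<epsilon> \<Delta> e nabla u"
  shows "monoidal_of_bialgebra X ((bang, bmap, \<delta>, \<epsilon>, \<Delta>, e), (nabla, u)) =
    ((bang, bmap, \<delta>, \<epsilon>, \<Delta>, e),
      (additive_bialgebra_modality.tensor_map X bang bmap \<delta> \<epsilon> \<Delta> e nabla u,
       additive_bialgebra_modality.unit_map X bmap \<delta> e u))"
proof -
  interpret additive_bialgebra_modality X bang bmap \<delta> \<epsilon> \<Delta> e nabla u by fact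
  show ?thesis by (simp only: monoidal_of_bialgebra.simps tensor_map_expand unit_map_def)
qed

lemma bialgebra_of_monoidal_eq:
  assumes "additive_linear X bang bmap \<delta> \<epsilon> \<Delta> e m mK"
  shows "bialgebra_of_monoidal X ((bang, bmap, \<delta>, \<epsilon>, \<Delta>, e), (m, mK)) =
    ((bang, bmap, \<delta>, \<epsilon>, \<Delta>, e),
      (additive_linear.mult X bmap \<delta> \<epsilon> e m, additive_linear.unit X bmap mK))"
proof -
  interpret additive_linear X bang bmap \<delta> \<epsilon> \<Delta> e m mK by fact
  show ?thesis
    by (simp add: fun_eq_iff mult_def unit_def tens_def)
qed

context
  fixes X :: "('o, 'a) additive_smc_data"
  assumes X: "additive_smc X"
begin

lemma monoidal_bialgebra_monoidal:
  assumes "M \<in> monoidal_coalgebra_modalities X"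
  shows "bialgebra_of_monoidal X M \<in> additive_bialgebra_modalities X"
    and "monoidal_of_bialgebra X (bialgebra_of_monoidal X M) = M"
    and "fst (bialgebra_of_monoidal X M) = fst M"
proof -
  obtain bang bmap \<delta> \<epsilon> \<Delta> e m mK where M: "M = ((bang, bmap, \<delta>, \<epsilon>, \<Delta>, e), (m, mK))"
    and l: "monoidal_coalgebra_modality X bang bmap \<delta> \<epsilon> \<Delta> e m mK"
    using assms unfolding monoidal_coalgebra_modalities_def by blast
  interpret additive_linear X bang bmap \<delta> \<epsilon> \<Delta> e m mK
    using X l by (rule additive_linear.intro)
  note eq = bialgebra_of_monoidal_eq[OF additive_linear_axioms]
  show "bialgebra_of_monoidal X M \<in> additive_bialgebra_modalities X"
    unfolding M eq additive_bialgebra_modalities_def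
    using additive_bialgebra_modality_of_monoidal by blast
  have "B.tensor_map = m" by (intro ext tensor_map_eq_m)
  then show "monoidal_of_bialgebra X (bialgebra_of_monoidal X M) = M"
    unfolding M eq monoidal_of_bialgebra_eq[OF additive_bialgebra_modality_of_monoidal]
    by (simp only: unit_map_eq_mK)
  show "fst (bialgebra_of_monoidal X M) = fst M" unfolding M eq by simp
qed

lemma bialgebra_monoidal_bialgebra:
  assumes "N \<in> additive_bialgebra_modalities X"
  shows "monoidal_of_bialgebra X N \<in> monoidal_coalgebra_modalities X"
    and "bialgebra_of_monoidal X (monoidal_of_bialgebra X N) = N"
    and "fst (monoidal_of_bialgebra X N) = fst N"
proof -
  obtain bang bmap \<delta> \<epsilon> \<Delta> e nabla u where N: "N = ((bang, bmap, \<delta>, \<epsilon>, \<Delta>, e), (nabla, u))"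
    and l: "additive_bialgebra_modality X bang bmap \<delta> \<epsilon> \<Delta> e nabla u"
    using assms unfolding additive_bialgebra_modalities_def by blast
  interpret additive_bialgebra_modality X bang bmap \<delta> \<epsilon> \<Delta> e nabla u by fact
  note eq = monoidal_of_bialgebra_eq[OF l]
  show "monoidal_of_bialgebra X N \<in> monoidal_coalgebra_modalities X"
    unfolding N eq monoidal_coalgebra_modalities_def
    using monoidal_coalgebra_modality_of_bialgebra by blast
  show "bialgebra_of_monoidal X (monoidal_of_bialgebra X N) = N"
    unfolding N eq by (simp only: bialgebra_of_monoidal.simps nabla_of_tensor_map u_of_unit_map)
  show "fst (monoidal_of_bialgebra X N) = fst N" unfolding N eq by simp
qed

lemma bij_bialgebra_of_monoidal:
  "bij_betw (bialgebra_of_monoidal X) (monoidal_coalgebra_modalities X) (additive_bialgebra_modalities X)"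
  by (rule bij_betw_byWitness[where f' = "monoidal_of_bialgebra X"])
    (use monoidal_bialgebra_monoidal bialgebra_monoidal_bialgebra in auto)

lemma bij_monoidal_of_bialgebra:
  "bij_betw (monoidal_of_bialgebra X) (additive_bialgebra_modalities X) (monoidal_coalgebra_modalities X)"
  by (rule bij_betw_byWitness[where f' = "bialgebra_of_monoidal X"])
    (use monoidal_bialgebra_monoidal bialgebra_monoidal_bialgebra in auto)

end

theorem theorem3p9:
  fixes X :: "('o, 'a) additive_smc_data"
  assumes "additive_smc X"
  shows "bij_betw (bialgebra_of_monoidal X)
           (monoidal_coalgebra_modalities X) (additive_bialgebra_modalities X)
       \<and> bij_betw (monoidal_of_bialgebra X)
           (additive_bialgebra_modalities X) (monoidal_coalgebra_modalities X)
       \<and> (\<forall>M \<in> monoidal_coalgebra_modalities X.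
            fst (bialgebra_of_monoidal X M) = fst M \<and>
            monoidal_of_bialgebra X (bialgebra_of_monoidal X M) = M)
       \<and> (\<forall>N \<in> additive_bialgebra_modalities X.
            fst (monoidal_of_bialgebra X N) = fst N \<and>
            bialgebra_of_monoidal X (monoidal_of_bialgebra X N) = N)
       \<and> ((\<exists>M. additive_linear_category X M) \<longleftrightarrow>
            (\<exists>N. additive_smc_with_additive_bialgebra_modality X N))
       \<and> bij_betw (\<lambda>(Y, M). (Y, bialgebra_of_monoidal Y M))
           {(Y :: ('o, 'a) additive_smc_data, M). additive_linear_category Y M}
           {(Y, N). additive_smc_with_additive_bialgebra_modality Y N}"
proof -
  have "bij_betw (\<lambda>(Y, M). (Y, bialgebra_of_monoidal Y M))
      {(Y :: ('o, 'a) additive_smc_data, M). additive_linear_category Y M}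
      {(Y, N). additive_smc_with_additive_bialgebra_modality Y N}"
    by (rule bij_betw_byWitness[where f' = "\<lambda>(Y, N). (Y, monoidal_of_bialgebra Y N)"])
      (auto simp: additive_linear_category_def additive_smc_with_additive_bialgebra_modality_def
        monoidal_bialgebra_monoidal bialgebra_monoidal_bialgebra
        simp del: bialgebra_of_monoidal.simps monoidal_of_bialgebra.simps)
  moreover have "(\<exists>M. additive_linear_category X M) \<longleftrightarrow>
      (\<exists>N. additive_smc_with_additive_bialgebra_modality X N)"
    unfolding additive_linear_category_def additive_smc_with_additive_bialgebra_modality_def
    using assms monoidal_bialgebra_monoidal(1) bialgebra_monoidal_bialgebra(1) by blast
  ultimately show ?thesis
    using bij_bialgebra_of_monoidal[OF assms] bij_monoidal_of_bialgebra[OF assms]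
      monoidal_bialgebra_monoidal[OF assms] bialgebra_monoidal_bialgebra[OF assms]
    by simp
qed

end
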